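(* Consider the state-dependent DMC with noncausal CSI at the transmitter described in the context. For every $R_K\geq 0$ and $B\geq 0$, the covert capacity with noncausal CSI satisfies $$C_{\mathrm{nc}}\geq \max\big(I(U;Y)-I(U;S)\big),$$ where the maximum is over conditional PMFs $P_{U|S}$ on a finite set $\mathcal{U}$ with $|\mathcal{U}|\leq \min\{|\mathcal{X}|+|\mathcal{Y}|+|\mathcal{Z}|+|\mathcal{S}|-2,\ |\mathcal{X}|\cdot|\mathcal{S}|+1\}$ and functions $x:\mathcal{U}\times\mathcal{S}\to\mathcal{X}$, evaluated under the joint distribution $P_S(s)P_{U|S}(u|s)\mathbbm{1}\{x=x(u,s)\}P_{Y,Z|S,X}(y,z|s,x)$, subject to $P_Z=Q_0$, $\mathrm{E}[b(X)]\leq B$, and $I(U;Z)-I(U;Y)<R_K$.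
   Context: A state-dependent discrete memoryless channel consists of finite alphabets $\mathcal{X}$ (input), $\mathcal{S}$ (state), $\mathcal{Y}$ (receiver output), $\mathcal{Z}$ (warden output), a state PMF $P_S$, and a channel law $P_{Y,Z|S,X}$. Over $n$ uses, the state sequence $S^n$ is IID $\sim P_S$, and given $(X^n,S^n)$ the pairs $(Y_i,Z_i)$ are conditionally independent with law $P_{Y,Z|S,X}(\cdot,\cdot|S_i,X_i)$. A designated "no input" symbol $x_0\in\mathcal{X}$ is fixed, and $Q_0(z)=\sum_{s}P_S(s)P_{Z|S,X}(z|s,x_0)$; $Q_0^{\times n}$ is its $n$-fold product. It is assumed that $\mathrm{supp}(Q_0)=\mathcal{Z}$. A cost function $b:\mathcal{X}\to[0,\infty)$ is given, with $b(x^n)=\frac1n\sum_{i=1}^n b(x_i)$. A secret key $K$ uniform on $[1:2^{nR_K}]$ and a message $M$ uniform on $[1:2^{nR}]$ are mutually independent and independent of $S^n$; $K$ is known to transmitter and receiver, while $S^n$ is known only to the transmitter. With causal CSI, an $(2^{nR},2^{nR_K},n)$ code consists of an encoder producing $X_i$ as a function of $(M,K,S^i)$ (and possibly private randomness of the transmitter independent of $(M,K,S^n)$), $i\in[1:n]$, and a decoder mapping $(Y^n,K)$ to $\hat M$. With noncausal CSI, the encoder produces $X^n$ from $(M,K,S^n)$ (and possibly such private randomness). $P_e^{(n)}=P(\hat M\neq M)$, and $\widehat{P}_{Z^n}$ is the distribution of the warden's output $Z^n$ induced by the code. A rate $R$ is achievable (for given $R_K,B$) if there is a sequence of codes with $\limsup_{n}\mathrm{E}[b(X^n)]\leq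 B$, $P_e^{(n)}\to 0$, and $D(\widehat{P}_{Z^n}\|Q_0^{\times n})\to 0$. The covert capacity $C_{\mathrm{c}}$ (causal CSI) resp. $C_{\mathrm{nc}}$ (noncausal CSI) is the supremum of achievable rates. *)

theory Defs
  imports "HOL-Probability.Probability"
begin

primrec iid_list :: "nat \<Rightarrow> 'a pmf \<Rightarrow> 'a list pmf" where
  "iid_list 0 p = return_pmf []"
| "iid_list (Suc n) p = bind_pmf p (\<lambda>a. map_pmf (\<lambda>as. a # as) (iid_list n p))"

fun chan_list :: "('s \<Rightarrow> 'x \<Rightarrow> 'o pmf) \<Rightarrow> ('s \<times> 'x) list \<Rightarrow> 'o list pmf" where
  "chan_list W [] = return_pmf []"
| "chan_list W ((s, x) # r) = bind_pmf (W s x) (\<lambda>v. map_pmf (\<lambda>vs. v # vs) (chan_list W r))"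

text \<open>No-input output distribution of the warden: Q0(z) = sum_s P_S(s) P_{Z|S,X}(z|s,x0).\<close>
definition Q0 :: "'s pmf \<Rightarrow> ('s \<Rightarrow> 'x \<Rightarrow> ('y \<times> 'z) pmf) \<Rightarrow> 'x \<Rightarrow> 'z pmf" where
  "Q0 PS W x0 = bind_pmf PS (\<lambda>s. map_pmf snd (W s x0))"

definition kl_div :: "'a pmf \<Rightarrow> 'a pmf \<Rightarrow> ereal" where
  "kl_div P Q = (if set_pmf P \<subseteq> set_pmf Q
     then ereal (\<Sum>a\<in>set_pmf P. pmf P a * log 2 (pmf P a / pmf Q a))
     else \<infinity>)"

definition mutual_info :: "('a \<times> 'b) pmf \<Rightarrow> real" where
  "mutual_info P = (\<Sum>ab\<in>set_pmf P. pmf P ab *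
      log 2 (pmf P ab / (pmf (map_pmf fst P) (fst ab) * pmf (map_pmf snd P) (snd ab))))"

text \<open>Number of messages / keys: the index set [1 : 2^{nR}] is read as {1..ceil(2^{nR})}.\<close>
definition num_idx :: "nat \<Rightarrow> real \<Rightarrow> nat" where
  "num_idx n R = nat \<lceil>2 powr (real n * R)\<rceil>"

definition avg_cost :: "('x \<Rightarrow> real) \<Rightarrow> 'x list \<Rightarrow> real" where
  "avg_cost b xs = (\<Sum>x\<leftarrow>xs. b x) / real (length xs)"

text \<open>Joint distribution of (M, K, S^n, X^n, (Y,Z)^n) induced by a (stochastic) encoder
  with noncausal CSI: X^n is drawn from enc m k s^n (the encoder's private randomness
  is absorbed in the stochastic map).\<close>
definition code_joint_nc ::
  "nat \<Rightarrow> real \<Rightarrow> real \<Rightarrow> 's pmf \<Rightarrow> ('s \<Rightarrow> 'x \<Rightarrow> ('y \<times> 'z) pmf)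
   \<Rightarrow> (nat \<Rightarrow> nat \<Rightarrow> 's list \<Rightarrow> 'x list pmf)
   \<Rightarrow> (nat \<times> nat \<times> 's list \<times> 'x list \<times> ('y \<times> 'z) list) pmf" where
  "code_joint_nc n R RK PS W enc =
     bind_pmf (pmf_of_set {1..num_idx n R}) (\<lambda>m.
     bind_pmf (pmf_of_set {1..num_idx n RK}) (\<lambda>k.
     bind_pmf (iid_list n PS) (\<lambda>s.
     bind_pmf (enc m k s) (\<lambda>x.
     map_pmf (\<lambda>yz. (m, k, s, x, yz)) (chan_list W (zip s x))))))"

definition achievable_nc ::
  "'s pmf \<Rightarrow> ('s \<Rightarrow> 'x \<Rightarrow> ('y \<times> 'z) pmf) \<Rightarrow> 'x \<Rightarrow> ('x \<Rightarrow> real) \<Rightarrow> real \<Rightarrow> real \<Rightarrow> real \<Rightarrow> bool" where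
  "achievable_nc PS W x0 b RK B R \<longleftrightarrow>
     (\<exists>(enc :: nat \<Rightarrow> nat \<Rightarrow> nat \<Rightarrow> 's list \<Rightarrow> 'x list pmf)
       (dec :: nat \<Rightarrow> 'y list \<Rightarrow> nat \<Rightarrow> nat).
        (\<forall>n m k s. length s = n \<longrightarrow> set_pmf (enc n m k s) \<subseteq> {xs. length xs = n})
      \<and> limsup (\<lambda>n. ereal (measure_pmf.expectation (code_joint_nc n R RK PS W (enc n))
                 (\<lambda>(m, k, s, x, yz). avg_cost b x))) \<le> ereal B
      \<and> (\<lambda>n. measure_pmf.prob (code_joint_nc n R RK PS W (enc n))
                 {(m, k, s, x, yz). dec n (map fst yz) k \<noteq> m}) \<longlonglongrightarrow> 0
      \<and> (\<lambda>n. kl_div (map_pmf (\<lambda>(m, k, s, x, yz). map snd yz) (code_joint_nc n R RK PS W (enc n)))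
                    (iid_list n (Q0 PS W x0))) \<longlonglongrightarrow> 0)"

definition covert_cap_nc ::
  "'s pmf \<Rightarrow> ('s \<Rightarrow> 'x \<Rightarrow> ('y \<times> 'z) pmf) \<Rightarrow> 'x \<Rightarrow> ('x \<Rightarrow> real) \<Rightarrow> real \<Rightarrow> real \<Rightarrow> ereal" where
  "covert_cap_nc PS W x0 b RK B = Sup {ereal R | R. achievable_nc PS W x0 b RK B R}"

definition gp_joint ::
  "'s pmf \<Rightarrow> ('s \<Rightarrow> 'u pmf) \<Rightarrow> ('u \<Rightarrow> 's \<Rightarrow> 'x) \<Rightarrow> ('s \<Rightarrow> 'x \<Rightarrow> ('y \<times> 'z) pmf)
   \<Rightarrow> ('s \<times> 'u \<times> 'x \<times> 'y \<times> 'z) pmf" where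
  "gp_joint PS PU xf W =
     bind_pmf PS (\<lambda>s. bind_pmf (PU s) (\<lambda>u.
       map_pmf (\<lambda>(y, z). (s, u, xf u s, y, z)) (W s (xf u s))))"

end

theory Submission
  imports Defs
begin

text \<open>
  Let \<open>V\<close> be the conditional law of the state given \<open>U\<close>. For \<open>0 < R < I(U;Y) - I(U;S)\<close> choose \<open>R'\<close> with
  \<open>I(U;S) < R'\<close>, \<open>R + R' < I(U;Y)\<close> and \<open>I(U;Z) < R + R\<^sub>K + R'\<close>, and draw codewords
  \<open>u(m,k,l)\<close>, \<open>l \<le> 2\<^bsup>nR'\<^esup>\<close>, independently from the product law of \<open>U\<close>. In an ideal experiment \<open>(m,k,l)\<close> is uniform
  and the state is generated from the codeword by \<open>V\<close>. The encoder samples the channel input from the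
  conditional law, in this experiment, of the input given the state, so the actual and the ideal law are as close
  as the actual and the ideal state law given \<open>(m,k)\<close>; by soft covering over \<open>l\<close> this distance is
  exponentially small. Soft covering over \<open>(m,k,l)\<close> makes the ideal law of the warden's output
  exponentially close to the product law, and threshold decoding finds \<open>m\<close>. Since the reference law is
  bounded below by \<open>q\<^sup>n\<close>, relative entropy is at most of order \<open>n\<close> times the variational distance.
  For \<open>R \<le> 0\<close> there is a single message, and sampling \<open>U\<close> memorylessly given the state reproduces
  the reference law exactly.
\<close>

subsection \<open>Expectations, variational distance and relative entropy\<close>

text \<open>The interval for \<open>R'\<close> is nonempty by the two rate hypotheses:
  \<open>I(U;S) < I(U;Y) - R\<close> is the choice of \<open>R\<close>, and
  \<open>I(U;Z) - R - RK < I(U;Y) - R\<close> is the strict key condition. Covering of the state has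
  to work for each \<open>(m,k)\<close> separately, since the true state is independent of message
  and key; it can use only the codewords of one bin. The covering at the warden may average over all
  three indices. The loss of order \<open>n\<close> in passing from variational distance to relative
  entropy means that merely vanishing distances are not enough. Hence all tails are bounded by
  Chernoff estimates for the information density, whose geometric decay survives a factor
  \<open>n\<close>. One codebook must serve four purposes: state covering, output covering, decoding
  and cost. They are added to one quantity whose average over the random codebook is small; some
  codebook does no worse than average, and as every summand is nonnegative, each is then small. This
  is why the cost enters through a squared deviation and not through its signed excess.\<close>

lemma expectation_bind_pmf:
  fixes f :: "'b \<Rightarrow> real"
  assumes bd: "\<And>b. b \<in> set_pmf (bind_pmf p K) \<Longrightarrow> \<bar>f b\<bar> \<le> B"
  shows "measure_pmf.expectation (bind_pmf p K) f
       = measure_pmf.expectation p (\<lambda>a. measure_pmf.expectation (K a) f)"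
proof -
  \<comment> \<open>The rule \<open>integral_bind\<close> asks for a bound everywhere, while
    \<open>f\<close> is bounded on the support only; cutting \<open>f\<close> off outside the
    support changes no expectation.\<close>
  define g where "g b = (if b \<in> set_pmf (bind_pmf p K) then f b else 0)" for b
  have g: "\<bar>g b\<bar> \<le> \<bar>B\<bar>" for b
    using bd[of b] by (cases "b \<in> set_pmf (bind_pmf p K)") (auto simp: g_def simp del: set_bind_pmf)
  have "measure_pmf.expectation (bind_pmf p K) f = measure_pmf.expectation (bind_pmf p K) g"
    by (intro integral_cong_AE) (auto simp: AE_measure_pmf_iff g_def)
  also have "\<dots> = measure_pmf.expectation p (\<lambda>a. measure_pmf.expectation (K a) g)"
    unfolding measure_pmf_bind
    by (rule integral_bind[where K="count_space UNIV" and B="\<bar>B\<bar>" and B'=1])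
      (use g in \<open>auto simp: measure_pmf_in_subprob_space measure_pmf.emeasure_space_1\<close>)
  also have "\<dots> = measure_pmf.expectation p (\<lambda>a. measure_pmf.expectation (K a) f)"
    by (intro integral_cong_AE) (auto simp: AE_measure_pmf_iff g_def intro!: integral_cong_AE)
  finally show ?thesis .
qed

lemma expectation_bind_pmf_finite:
  fixes f :: "'b \<Rightarrow> real"
  assumes "finite (set_pmf (bind_pmf p K))"
  shows "measure_pmf.expectation (bind_pmf p K) f
       = measure_pmf.expectation p (\<lambda>a. measure_pmf.expectation (K a) f)"
proof (rule expectation_bind_pmf)
  fix b assume "b \<in> set_pmf (bind_pmf p K)"
  then show "\<bar>f b\<bar> \<le> (\<Sum>b\<in>set_pmf (bind_pmf p K). \<bar>f b\<bar>)"
    using assms by (intro member_le_sum) auto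
qed

lemma expectation_indicator_eq:
  "measure_pmf.prob p A = measure_pmf.expectation p (indicator A)"
  by simp

lemma prob_bind_pmf:
  "measure_pmf.prob (bind_pmf p K) A = measure_pmf.expectation p (\<lambda>a. measure_pmf.prob (K a) A)"
  unfolding expectation_indicator_eq
  by (rule expectation_bind_pmf[where B=1]) (auto simp: indicator_def)

lemma abs_expectation_le:
  fixes f :: "'a \<Rightarrow> real"
  assumes bd: "\<And>a. a \<in> set_pmf p \<Longrightarrow> \<bar>f a\<bar> \<le> B"
  shows "\<bar>measure_pmf.expectation p f\<bar> \<le> B"
proof -
  have B: "B \<ge> 0" using set_pmf_not_empty[of p] bd by force
  have int: "integrable (measure_pmf p) f"
    by (rule measure_pmf.integrable_const_bound[where B=B]) (auto simp: AE_measure_pmf_iff bd)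
  have "measure_pmf.expectation p f \<le> B"
    by (rule measure_pmf.integral_le_const[OF int]) (use bd in \<open>force simp: AE_measure_pmf_iff\<close>)
  moreover have "measure_pmf.expectation p f \<ge> -B"
    by (rule measure_pmf.integral_ge_const[OF int]) (use bd in \<open>force simp: AE_measure_pmf_iff\<close>)
  ultimately show ?thesis by simp
qed

lemma expectation_mono_finite:
  fixes f g :: "'a \<Rightarrow> real"
  assumes "finite (set_pmf p)" "\<And>a. a \<in> set_pmf p \<Longrightarrow> f a \<le> g a"
  shows "measure_pmf.expectation p f \<le> measure_pmf.expectation p g"
  by (intro integral_mono_AE integrable_measure_pmf_finite assms(1))
    (auto simp: AE_measure_pmf_iff assms(2))

lemma expectation_nonneg:
  fixes f :: "'a \<Rightarrow> real"
  assumes "\<And>a. a \<in> set_pmf p \<Longrightarrow> 0 \<le> f a"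
  shows "0 \<le> measure_pmf.expectation p f"
  by (intro integral_nonneg_AE) (auto simp: AE_measure_pmf_iff assms)

lemma expectation_cong_pmf:
  fixes f g :: "'a \<Rightarrow> real"
  assumes "\<And>a. a \<in> set_pmf p \<Longrightarrow> f a = g a"
  shows "measure_pmf.expectation p f = measure_pmf.expectation p g"
  by (intro integral_cong_AE) (auto simp: AE_measure_pmf_iff assms)

text \<open>The selection step of the probabilistic method: it will pick a codebook that is no worse
  than the random average.\<close>

lemma exists_le_expectation:
  fixes f :: "'a \<Rightarrow> real"
  assumes fin: "finite (set_pmf p)"
  shows "\<exists>a\<in>set_pmf p. f a \<le> measure_pmf.expectation p f"
proof (rule ccontr)
  assume a: "\<not> ?thesis"
  have "(\<Sum>a\<in>set_pmf p. pmf p a * measure_pmf.expectation p f) < (\<Sum>a\<in>set_pmf p. pmf p a * f a)"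
    using a by (intro sum_strict_mono fin)
      (auto simp: set_pmf_not_empty not_le pmf_positive intro!: mult_strict_left_mono)
  also have "\<dots> = measure_pmf.expectation p f"
    by (subst integral_measure_pmf[OF fin]) auto
  finally show False
    by (simp flip: sum_distrib_right add: sum_pmf_eq_1[OF fin order_refl])
qed

text \<open>Only meaningful for distributions with finite support.\<close>
definition l1_dist :: "'a pmf \<Rightarrow> 'a pmf \<Rightarrow> real" where
  "l1_dist p q = (\<Sum>a\<in>set_pmf p \<union> set_pmf q. \<bar>pmf p a - pmf q a\<bar>)"

lemma l1_dist_nonneg: "l1_dist p q \<ge> 0"
  by (auto simp: l1_dist_def intro!: sum_nonneg)

lemma l1_dist_eq_sum:
  assumes "finite A" "set_pmf p \<subseteq> A" "set_pmf q \<subseteq> A"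
  shows "l1_dist p q = (\<Sum>a\<in>A. \<bar>pmf p a - pmf q a\<bar>)"
  unfolding l1_dist_def
  by (rule sum.mono_neutral_left) (use assms in \<open>auto simp: set_pmf_eq\<close>)

lemma expectation_diff_le_l1_dist:
  fixes h :: "'a \<Rightarrow> real"
  assumes fin: "finite (set_pmf p)" "finite (set_pmf q)"
    and bd: "\<And>a. a \<in> set_pmf p \<union> set_pmf q \<Longrightarrow> \<bar>h a\<bar> \<le> B"
  shows "\<bar>measure_pmf.expectation p h - measure_pmf.expectation q h\<bar> \<le> B * l1_dist p q"
proof -
  let ?A = "set_pmf p \<union> set_pmf q"
  have finA: "finite ?A" using fin by simp
  have p: "measure_pmf.expectation p h = (\<Sum>a\<in>?A. pmf p a * h a)"
    by (subst integral_measure_pmf[OF finA]) auto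
  have q: "measure_pmf.expectation q h = (\<Sum>a\<in>?A. pmf q a * h a)"
    by (subst integral_measure_pmf[OF finA]) auto
  have "\<bar>measure_pmf.expectation p h - measure_pmf.expectation q h\<bar>
      = \<bar>\<Sum>a\<in>?A. (pmf p a - pmf q a) * h a\<bar>"
    unfolding p q by (simp add: sum_subtractf left_diff_distrib)
  also have "\<dots> \<le> (\<Sum>a\<in>?A. \<bar>(pmf p a - pmf q a) * h a\<bar>)"
    by (rule sum_abs)
  also have "\<dots> \<le> (\<Sum>a\<in>?A. B * \<bar>pmf p a - pmf q a\<bar>)"
    by (intro sum_mono) (auto simp: abs_mult mult.commute[of B] bd intro!: mult_left_mono)
  finally show ?thesis
    by (simp add: l1_dist_def sum_distrib_left)
qed

text \<open>Converse of \<open>expectation_diff_le_l1_dist\<close>: the sign of the difference is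
  the extremal test. Closeness of the two experiments can thus be carried as a statement about
  bounded tests, which passes to every marginal, and be turned into a distance only at the warden's
  output.\<close>

lemma l1_dist_le_by_tests:
  assumes fin: "finite (set_pmf p)" "finite (set_pmf q)"
    and test: "\<And>h :: 'a \<Rightarrow> real. (\<And>a. \<bar>h a\<bar> \<le> 1) \<Longrightarrow>
      \<bar>measure_pmf.expectation p h - measure_pmf.expectation q h\<bar> \<le> e"
  shows "l1_dist p q \<le> e"
proof -
  let ?A = "set_pmf p \<union> set_pmf q"
  define h where "h a = sgn (pmf p a - pmf q a)" for a
  have finA: "finite ?A" using fin by simp
  have p: "measure_pmf.expectation p h = (\<Sum>a\<in>?A. pmf p a * h a)"
    by (subst integral_measure_pmf[OF finA]) auto
  have q: "measure_pmf.expectation q h = (\<Sum>a\<in>?A. pmf q a * h a)"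
    by (subst integral_measure_pmf[OF finA]) auto
  have "l1_dist p q = (\<Sum>a\<in>?A. pmf p a * h a - pmf q a * h a)"
    unfolding l1_dist_def h_def by (intro sum.cong) (auto simp: sgn_if algebra_simps)
  also have "\<dots> = measure_pmf.expectation p h - measure_pmf.expectation q h"
    unfolding p q by (simp add: sum_subtractf)
  also have "\<dots> \<le> e"
    using test[of h] by (force simp: h_def sgn_if)
  finally show ?thesis .
qed

lemma l1_dist_triangle:
  assumes fin: "finite (set_pmf p)" "finite (set_pmf q)" "finite (set_pmf r)"
  shows "l1_dist p r \<le> l1_dist p q + l1_dist q r"
proof -
  let ?A = "set_pmf p \<union> set_pmf q \<union> set_pmf r"
  have "finite ?A" using fin by simp
  then show ?thesis
    by (subst (1 2 3) l1_dist_eq_sum[of ?A])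
      (auto simp flip: sum.distrib intro!: sum_mono)
qed

section \<open>Relative entropy in terms of variational distance\<close>

text \<open>The correction \<open>- p + q\<close> sums to zero over two probability vectors and
  makes each single term nonnegative. For \<open>p < q\<close> the logarithmic part is nonpositive;
  otherwise \<open>q * ln (p / q) \<le> p - q\<close> leaves \<open>(p - q) * ln (p / q)\<close>,
  and \<open>p / q\<close> is at most \<open>1 / \<mu>\<close>.\<close>

lemma divergence_term_bounds:
  fixes p q \<mu> :: real
  assumes p: "0 \<le> p" "p \<le> 1" and q: "\<mu> \<le> q" "q \<le> 1" and \<mu>: "0 < \<mu>"
  shows "0 \<le> p * ln (p / q) - p + q"
    and "p * ln (p / q) - p + q \<le> \<bar>p - q\<bar> * (1 + ln (1 / \<mu>))"
proof -
  have q0: "q > 0" and \<mu>1: "\<mu> \<le> 1" using q \<mu> by auto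
  have l0: "ln (1 / \<mu>) \<ge> 0" using \<mu> \<mu>1 by simp
  show "0 \<le> p * ln (p / q) - p + q"
  proof (cases "p = 0")
    case False
    then have p0: "p > 0" using p by simp
    have "ln (q / p) \<le> q / p - 1" using p0 q0 by (intro ln_le_minus_one) auto
    then have "p * ln (q / p) \<le> p * (q / p - 1)" using p0 by (intro mult_left_mono) auto
    also have "\<dots> = q - p" using p0 by (simp add: field_simps)
    finally show ?thesis using p0 q0 by (simp add: ln_div algebra_simps)
  qed (use q0 in auto)
  show "p * ln (p / q) - p + q \<le> \<bar>p - q\<bar> * (1 + ln (1 / \<mu>))"
  proof (cases "p < q")
    case True
    have "p * ln (p / q) \<le> 0"
      using p True q0 by (cases "p = 0") (auto simp: mult_le_0_iff)
    then have "p * ln (p / q) - p + q \<le> \<bar>p - q\<bar> * 1" using True by simp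
    also have "\<dots> \<le> \<bar>p - q\<bar> * (1 + ln (1 / \<mu>))"
      using l0 by (intro mult_left_mono) auto
    finally show ?thesis .
  next
    case False
    then have p0: "p > 0" using q0 by simp
    have "q * ln (p / q) \<le> q * (p / q - 1)"
      using q0 p0 by (intro mult_left_mono ln_le_minus_one) auto
    also have "\<dots> = p - q" using q0 by (simp add: field_simps)
    finally have "p * ln (p / q) - p + q \<le> (p - q) * ln (p / q)"
      by (simp add: algebra_simps)
    also have "\<dots> \<le> (p - q) * ln (1 / \<mu>)"
      using False q0 p0 p q \<mu> by (intro mult_left_mono ln_mono frac_le) auto
    also have "\<dots> \<le> \<bar>p - q\<bar> * (1 + ln (1 / \<mu>))"
      using False l0 by (simp add: algebra_simps)
    finally show ?thesis .
  qed
qed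

lemma
  assumes fin: "finite (set_pmf Q)" and sub: "set_pmf P \<subseteq> set_pmf Q"
    and \<mu>: "0 < \<mu>" "\<And>a. a \<in> set_pmf Q \<Longrightarrow> \<mu> \<le> pmf Q a"
  shows kl_div_nonneg: "0 \<le> kl_div P Q"
    and kl_div_le_l1_dist: "kl_div P Q \<le> ereal (l1_dist P Q * (1 + ln (1 / \<mu>)) / ln 2)"
proof -
  let ?d = "\<lambda>a. pmf P a * ln (pmf P a / pmf Q a) - pmf P a + pmf Q a"
  define D where "D = (\<Sum>a\<in>set_pmf P. pmf P a * log 2 (pmf P a / pmf Q a))"
  have D: "kl_div P Q = ereal D" using sub by (simp add: kl_div_def D_def)
  have "D * ln 2 = (\<Sum>a\<in>set_pmf P. pmf P a * ln (pmf P a / pmf Q a))"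
    by (simp add: D_def log_def sum_distrib_right)
  also have "\<dots> = (\<Sum>a\<in>set_pmf Q. pmf P a * ln (pmf P a / pmf Q a))"
    by (rule sum.mono_neutral_left) (use fin sub in \<open>auto simp: set_pmf_eq\<close>)
  \<comment> \<open>The corrections cancel in total, since both laws have mass one on the support of
    \<open>Q\<close>.\<close>
  also have "\<dots> = (\<Sum>a\<in>set_pmf Q. ?d a)"
    using sum_pmf_eq_1[OF fin sub] sum_pmf_eq_1[OF fin order_refl]
    by (simp add: sum.distrib sum_subtractf)
  finally have eq: "D * ln 2 = (\<Sum>a\<in>set_pmf Q. ?d a)" .
  have "0 \<le> (\<Sum>a\<in>set_pmf Q. ?d a)"
    using \<mu> by (intro sum_nonneg divergence_term_bounds(1)[where \<mu>=\<mu>]) (auto simp: pmf_le_1)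
  then show "0 \<le> kl_div P Q" unfolding D eq[symmetric] by (simp add: zero_le_mult_iff)
  have "(\<Sum>a\<in>set_pmf Q. ?d a) \<le> (\<Sum>a\<in>set_pmf Q. \<bar>pmf P a - pmf Q a\<bar> * (1 + ln (1 / \<mu>)))"
    using \<mu> by (intro sum_mono divergence_term_bounds(2)) (auto simp: pmf_le_1)
  also have "\<dots> = l1_dist P Q * (1 + ln (1 / \<mu>))"
    using sub by (subst l1_dist_eq_sum[OF fin]) (auto simp: sum_distrib_right)
  finally show "kl_div P Q \<le> ereal (l1_dist P Q * (1 + ln (1 / \<mu>)) / ln 2)"
    unfolding D eq[symmetric] by (simp add: field_simps)
qed

text \<open>Source of both conditional laws in the proof: the state given \<open>U\<close>, and the
  channel input given the state sequence. Off the support of the first marginal the kernel is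
  arbitrary.\<close>

lemma pmf_disintegration:
  fixes J :: "('a \<times> 'b) pmf"
  shows "\<exists>K. J = bind_pmf (map_pmf fst J) (\<lambda>a. map_pmf (Pair a) (K a))"
proof -
  define C where "C a = cond_pmf J {y. fst y = a}" for a
  have ne: "set_pmf J \<inter> {y. fst y = a} \<noteq> {}" if "a \<in> set_pmf (map_pmf fst J)" for a
    using that by auto
  have "J = bind_pmf (map_pmf fst J) (\<lambda>a. cond_pmf J {y. a = fst y})"
  proof (rule bind_cond_pmf_cancel[symmetric])
    fix x :: 'a and y :: "'a \<times> 'b" assume "x = fst y"
    then have "{x'. x' = fst y} = {x}" by auto
    then show "measure_pmf.prob J {y. x = fst y}
        = measure_pmf.prob (map_pmf fst J) {x. x = fst y}"
      by (simp add: vimage_def eq_commute)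
  qed auto
  also have "\<dots> = bind_pmf (map_pmf fst J) (\<lambda>a. map_pmf (Pair a) (map_pmf snd (C a)))"
  proof (rule bind_pmf_cong[OF refl])
    fix a assume a: "a \<in> set_pmf (map_pmf fst J)"
    have "map_pmf (Pair a) (map_pmf snd (C a)) = map_pmf id (C a)"
      unfolding map_pmf_comp using ne[OF a]
      by (intro map_pmf_cong) (auto simp: C_def set_cond_pmf)
    then show "cond_pmf J {y. a = fst y} = map_pmf (Pair a) (map_pmf snd (C a))"
      by (simp add: C_def eq_commute pmf.map_id)
  qed
  finally show ?thesis by (rule exI[of _ "\<lambda>a. map_pmf snd (C a)"])
qed

subsection \<open>Memoryless kernels and large deviations\<close>

text \<open>The product kernel in the recursive shape of \<open>iid_list\<close>, so that one
  induction opens both; \<open>chan_list\<close> is its instance for pairs of state and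
  input.\<close>

primrec mem_chan :: "('a \<Rightarrow> 'b pmf) \<Rightarrow> 'a list \<Rightarrow> 'b list pmf" where
  "mem_chan T [] = return_pmf []"
| "mem_chan T (u # us) = bind_pmf (T u) (\<lambda>v. map_pmf (\<lambda>vs. v # vs) (mem_chan T us))"

lemma length_iid_list: "xs \<in> set_pmf (iid_list n p) \<Longrightarrow> length xs = n"
  by (induction n arbitrary: xs) force+

lemma length_mem_chan: "vs \<in> set_pmf (mem_chan T us) \<Longrightarrow> length vs = length us"
  by (induction us arbitrary: vs) auto

lemma finite_set_iid_list [intro, simp]: "finite (set_pmf p) \<Longrightarrow> finite (set_pmf (iid_list n p))"
  by (induction n) auto

lemma finite_set_mem_chan [intro, simp]:
  "(\<And>u. finite (set_pmf (T u))) \<Longrightarrow> finite (set_pmf (mem_chan T us))"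
  by (induction us) auto

lemma set_iid_list_full:
  assumes "set_pmf p = UNIV" "length xs = n"
  shows "xs \<in> set_pmf (iid_list n p)"
  using assms(2) by (induction n arbitrary: xs) (auto simp: assms(1) length_Suc_conv)

lemma pmf_bind_map_Cons:
  "pmf (bind_pmf p (\<lambda>v. map_pmf (\<lambda>vs. v # vs) q)) (x # xs) = pmf p x * pmf q xs"
proof -
  have "bind_pmf p (\<lambda>v. map_pmf (\<lambda>vs. v # vs) q) = map_pmf (\<lambda>(v, vs). v # vs) (pair_pmf p q)"
    by (simp add: pair_pmf_def map_bind_pmf map_pmf_def bind_assoc_pmf bind_return_pmf)
  moreover have "inj (\<lambda>(v :: 'a, vs). v # vs)" by (auto intro!: injI)
  ultimately show ?thesis
    using pmf_map_inj'[of "\<lambda>(v :: 'a, vs). v # vs" "pair_pmf p q" "(x, xs)"] by (simp add: pmf_pair)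
qed

lemma pmf_iid_list_Cons: "pmf (iid_list (Suc n) p) (x # xs) = pmf p x * pmf (iid_list n p) xs"
  by (simp add: pmf_bind_map_Cons)

lemma pmf_mem_chan_Cons: "pmf (mem_chan T (u # us)) (v # vs) = pmf (T u) v * pmf (mem_chan T us) vs"
  by (simp add: pmf_bind_map_Cons)

lemma pmf_iid_list_ge:
  assumes \<mu>: "\<And>a. a \<in> set_pmf p \<Longrightarrow> \<mu> \<le> pmf p a" "0 \<le> \<mu>" and "xs \<in> set_pmf (iid_list n p)"
  shows "\<mu> ^ n \<le> pmf (iid_list n p) xs"
  using assms(3)
proof (induction n arbitrary: xs)
  case (Suc n)
  then obtain y ys where "xs = y # ys" "y \<in> set_pmf p" "ys \<in> set_pmf (iid_list n p)" by auto
  with Suc.IH \<mu> show ?case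
    by (simp add: pmf_iid_list_Cons mult_mono del: iid_list.simps)
qed simp

lemma iid_list_bind_mem_chan:
  "bind_pmf (iid_list n p) (mem_chan T) = iid_list n (bind_pmf p T)"
proof (induction n)
  case (Suc n)
  have "bind_pmf (iid_list (Suc n) p) (mem_chan T)
      = bind_pmf p (\<lambda>a. bind_pmf (iid_list n p) (\<lambda>as. bind_pmf (T a) (\<lambda>v.
          map_pmf (\<lambda>vs. v # vs) (mem_chan T as))))"
    by (simp add: bind_assoc_pmf bind_map_pmf)
  \<comment> \<open>The first output letter does not depend on the remaining inputs, so the two
    draws commute.\<close>
  also have "\<dots> = bind_pmf p (\<lambda>a. bind_pmf (T a) (\<lambda>v. bind_pmf (iid_list n p) (\<lambda>as.
          map_pmf (\<lambda>vs. v # vs) (mem_chan T as))))"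
    by (subst bind_commute_pmf) simp
  also have "\<dots> = bind_pmf p (\<lambda>a. bind_pmf (T a) (\<lambda>v. map_pmf (\<lambda>vs. v # vs) (iid_list n (bind_pmf p T))))"
    by (simp flip: map_bind_pmf add: Suc)
  finally show ?case by (simp add: bind_assoc_pmf)
qed (simp add: bind_return_pmf)

lemma map_mem_chan: "map_pmf (map f) (mem_chan T us) = mem_chan (\<lambda>u. map_pmf f (T u)) us"
proof (induction us)
  case (Cons u us)
  have "map_pmf (map f) (mem_chan T (u # us))
     = bind_pmf (T u) (\<lambda>v. map_pmf (\<lambda>vs. f v # vs) (map_pmf (map f) (mem_chan T us)))"
    by (simp add: map_bind_pmf map_pmf_comp)
  then show ?case by (simp add: Cons bind_map_pmf)
qed simp

lemma map_zip_mem_chan: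
  "map_pmf (zip us) (mem_chan T us) = mem_chan (\<lambda>u. map_pmf (Pair u) (T u)) us"
proof (induction us)
  case (Cons u us)
  have "map_pmf (zip (u # us)) (mem_chan T (u # us))
     = bind_pmf (T u) (\<lambda>v. map_pmf (\<lambda>vs. (u, v) # vs) (map_pmf (zip us) (mem_chan T us)))"
    by (simp add: map_bind_pmf map_pmf_comp)
  then show ?case by (simp add: Cons bind_map_pmf)
qed simp

lemma iid_list_zip_mem_chan:
  "bind_pmf (iid_list n p) (\<lambda>us. map_pmf (zip us) (mem_chan T us))
    = iid_list n (bind_pmf p (\<lambda>u. map_pmf (Pair u) (T u)))"
  unfolding map_zip_mem_chan by (rule iid_list_bind_mem_chan)

text \<open>Passes from the blockwise channel use in the definition of a code to a single memoryless
  kernel with triples as outputs, so that its input and output marginals become instances of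
  \<open>map_mem_chan\<close>.\<close>

lemma mem_chan_state_chan_list:
  "bind_pmf (mem_chan V us) (\<lambda>s. map_pmf (\<lambda>yz. (s, map2 xf us s, yz)) (chan_list W (zip s (map2 xf us s))))
   = map_pmf (\<lambda>t. (map fst t, map (fst \<circ> snd) t, map (snd \<circ> snd) t))
       (mem_chan (\<lambda>u. bind_pmf (V u) (\<lambda>s. map_pmf (\<lambda>yz. (s, xf u s, yz)) (W s (xf u s)))) us)"
proof (induction us)
  case (Cons u us)
  let ?G = "\<lambda>u. bind_pmf (V u) (\<lambda>s. map_pmf (\<lambda>yz. (s, xf u s, yz)) (W s (xf u s)))"
  let ?sp = "\<lambda>t. (map fst t, map (fst \<circ> snd) t, map (snd \<circ> snd) t)"
  let ?c = "\<lambda>s' w. \<lambda>(a, b, c). (s' # a, xf u s' # b, w # c)"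
  have "bind_pmf (mem_chan V (u # us)) (\<lambda>s. map_pmf (\<lambda>yz. (s, map2 xf (u # us) s, yz))
          (chan_list W (zip s (map2 xf (u # us) s))))
      = bind_pmf (V u) (\<lambda>s'. bind_pmf (mem_chan V us) (\<lambda>s. bind_pmf (W s' (xf u s'))
         (\<lambda>w. map_pmf (?c s' w) (map_pmf (\<lambda>yz. (s, map2 xf us s, yz)) (chan_list W (zip s (map2 xf us s)))))))"
    by (simp add: bind_assoc_pmf bind_map_pmf map_bind_pmf map_pmf_comp)
  also have "\<dots> = bind_pmf (V u) (\<lambda>s'. bind_pmf (W s' (xf u s')) (\<lambda>w. bind_pmf (mem_chan V us) (\<lambda>s.
         map_pmf (?c s' w) (map_pmf (\<lambda>yz. (s, map2 xf us s, yz)) (chan_list W (zip s (map2 xf us s)))))))"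
    by (intro bind_pmf_cong refl bind_commute_pmf)
  also have "\<dots> = bind_pmf (V u) (\<lambda>s'. bind_pmf (W s' (xf u s')) (\<lambda>w.
         map_pmf (?c s' w) (map_pmf ?sp (mem_chan ?G us))))"
    by (simp only: Cons flip: map_bind_pmf)
  also have "\<dots> = map_pmf ?sp (mem_chan ?G (u # us))"
    by (simp add: bind_assoc_pmf bind_map_pmf map_bind_pmf map_pmf_comp)
  finally show ?case .
qed (simp add: bind_return_pmf)

lemma chan_list_eq_mem_chan: "chan_list W sx = mem_chan (\<lambda>(s, x). W s x) sx"
  by (induction sx) auto

section \<open>Exponential tail bounds and moments of i.i.d. sums\<close>

text \<open>The moment generating function is \<open>1\<close> at \<open>0\<close> and its slope
  there is the mean of \<open>g\<close>, so it drops below \<open>1\<close> just to the right of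
  \<open>0\<close>.\<close>

lemma chernoff_exponent:
  fixes p :: "'a pmf" and g :: "'a \<Rightarrow> real"
  assumes fin: "finite (set_pmf p)" and neg: "measure_pmf.expectation p g < 0"
  shows "\<exists>t>0. measure_pmf.expectation p (\<lambda>a. exp (t * g a)) < 1"
proof -
  let ?S = "set_pmf p"
  define \<phi> where "\<phi> t = (\<Sum>a\<in>?S. pmf p a * exp (t * g a))" for t
  have e: "measure_pmf.expectation p h = (\<Sum>a\<in>?S. pmf p a * h a)" for h :: "'a \<Rightarrow> real"
    by (subst integral_measure_pmf[OF fin]) auto
  have "(\<phi> has_real_derivative (\<Sum>a\<in>?S. pmf p a * (g a * exp (0 * g a)))) (at 0)"
    unfolding \<phi>_def by (auto intro!: derivative_eq_intros sum.cong)
  moreover have "(\<Sum>a\<in>?S. pmf p a * (g a * exp (0 * g a))) = measure_pmf.expectation p g"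
    unfolding e by (rule sum.cong) auto
  ultimately have "DERIV \<phi> 0 :> measure_pmf.expectation p g" by simp
  from DERIV_neg_dec_right[OF this neg] obtain d where "d > 0" and d: "\<And>h. 0 < h \<Longrightarrow> h < d \<Longrightarrow> \<phi> (0 + h) < \<phi> 0"
    by auto
  moreover have "\<phi> 0 = 1" by (simp add: \<phi>_def sum_pmf_eq_1[OF fin order_refl])
  ultimately have "\<phi> (d / 2) < 1" using d[of "d / 2"] by simp
  with \<open>d > 0\<close> show ?thesis by (intro exI[of _ "d / 2"]) (auto simp: e \<phi>_def)
qed

lemma expectation_iid_list_Cons:
  fixes f :: "'a list \<Rightarrow> real"
  assumes "finite (set_pmf p)"
  shows "measure_pmf.expectation (iid_list (Suc n) p) f
     = measure_pmf.expectation p (\<lambda>x. measure_pmf.expectation (iid_list n p) (\<lambda>xs. f (x # xs)))"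
  by (simp only: iid_list.simps, subst expectation_bind_pmf_finite) (use assms in auto)

lemma expectation_iid_list_exp_sum:
  fixes g :: "'a \<Rightarrow> real"
  assumes fin: "finite (set_pmf p)"
  shows "measure_pmf.expectation (iid_list n p) (\<lambda>xs. exp (t * sum_list (map g xs)))
       = measure_pmf.expectation p (\<lambda>a. exp (t * g a)) ^ n"
proof (induction n)
  case (Suc n)
  show ?case
    by (simp add: expectation_iid_list_Cons[OF fin] ring_distribs exp_add Suc del: iid_list.simps)
qed simp

text \<open>Exponential Markov bound: the indicator of a nonnegative sum lies below the exponential
  of \<open>t\<close> times the sum, whose mean factorizes.\<close>

lemma chernoff_iid_list:
  fixes p :: "'a pmf" and g :: "'a \<Rightarrow> real"
  assumes fin: "finite (set_pmf p)" and neg: "measure_pmf.expectation p g < 0"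
  shows "\<exists>\<rho>. 0 \<le> \<rho> \<and> \<rho> < 1 \<and>
    (\<forall>n. measure_pmf.prob (iid_list n p) {xs. 0 \<le> sum_list (map g xs)} \<le> \<rho> ^ n)"
proof -
  obtain t where t: "t > 0" and lt: "measure_pmf.expectation p (\<lambda>a. exp (t * g a)) < 1"
    using chernoff_exponent[OF assms] by blast
  have "measure_pmf.prob (iid_list n p) {xs. 0 \<le> sum_list (map g xs)}
      \<le> measure_pmf.expectation p (\<lambda>a. exp (t * g a)) ^ n" for n
  proof -
    have "measure_pmf.prob (iid_list n p) {xs. 0 \<le> sum_list (map g xs)}
       \<le> measure_pmf.expectation (iid_list n p) (\<lambda>xs. exp (t * sum_list (map g xs)))"
      unfolding expectation_indicator_eq
      by (rule expectation_mono_finite) (use fin t in \<open>auto simp: indicator_def\<close>)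
    then show ?thesis by (simp add: expectation_iid_list_exp_sum[OF fin])
  qed
  with lt show ?thesis
    by (intro exI[of _ "measure_pmf.expectation p (\<lambda>a. exp (t * g a))"])
      (auto intro!: expectation_nonneg)
qed

lemma expectation_sum_list_iid:
  fixes g :: "'a \<Rightarrow> real"
  assumes fin: "finite (set_pmf p)"
  shows "measure_pmf.expectation (iid_list n p) (\<lambda>xs. sum_list (map g xs))
    = n * measure_pmf.expectation p g"
proof (induction n)
  case (Suc n)
  have [simp]: "integrable (iid_list n p) f" "integrable p f'" for f :: "'a list \<Rightarrow> real" and f' :: "'a \<Rightarrow> real"
    by (intro integrable_measure_pmf_finite; use fin in auto)+
  show ?case
    by (simp add: expectation_iid_list_Cons[OF fin] Suc algebra_simps del: iid_list.simps)
qed simp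

lemma expectation_square_sum_list_iid:
  fixes g :: "'a \<Rightarrow> real"
  assumes fin: "finite (set_pmf p)" and g0: "measure_pmf.expectation p g = 0"
  shows "measure_pmf.expectation (iid_list n p) (\<lambda>xs. (sum_list (map g xs))\<^sup>2)
    = n * measure_pmf.expectation p (\<lambda>a. (g a)\<^sup>2)"
proof (induction n)
  case (Suc n)
  have [simp]: "integrable (iid_list n p) f" "integrable p f'" for f :: "'a list \<Rightarrow> real" and f' :: "'a \<Rightarrow> real"
    by (intro integrable_measure_pmf_finite; use fin in auto)+
  show ?case
    by (simp add: expectation_iid_list_Cons[OF fin] Suc power2_sum expectation_sum_list_iid[OF fin] g0
      algebra_simps del: iid_list.simps)
qed simp

subsection \<open>Soft covering and packing for pairwise independent codebooks\<close>

lemma expectation_abs_le_sqrt: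
  fixes f :: "'a \<Rightarrow> real"
  assumes fin: "finite (set_pmf p)"
  shows "measure_pmf.expectation p (\<lambda>x. \<bar>f x\<bar>) \<le> sqrt (measure_pmf.expectation p (\<lambda>x. (f x)\<^sup>2))"
proof (rule real_le_rsqrt)
  have "measure_pmf.variance p (\<lambda>x. \<bar>f x\<bar>) \<ge> 0" by simp
  then show "(measure_pmf.expectation p (\<lambda>x. \<bar>f x\<bar>))\<^sup>2 \<le> measure_pmf.expectation p (\<lambda>x. (f x)\<^sup>2)"
    by (subst (asm) measure_pmf.variance_eq) (auto intro!: integrable_measure_pmf_finite fin)
qed

text \<open>Variances of averages and the union bound over rivals see two codewords at a time, so
  nothing more of the joint law is recorded. The index set is a parameter because the state is
  covered by the codewords of a single bin.\<close>

definition pairwise_iid :: "('i \<Rightarrow> 'a) pmf \<Rightarrow> 'i set \<Rightarrow> 'a pmf \<Rightarrow> bool" where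
  "pairwise_iid D I p \<longleftrightarrow> (\<forall>i\<in>I. map_pmf (\<lambda>C. C i) D = p) \<and>
     (\<forall>i\<in>I. \<forall>j\<in>I. i \<noteq> j \<longrightarrow> map_pmf (\<lambda>C. (C i, C j)) D = pair_pmf p p)"

lemma pairwise_iid_Pi_pmf:
  assumes fin: "finite I"
  shows "pairwise_iid (Pi_pmf I d (\<lambda>_. p)) I p"
  unfolding pairwise_iid_def
proof (intro conjI ballI impI)
  fix i assume i: "i \<in> I"
  then show "map_pmf (\<lambda>C. C i) (Pi_pmf I d (\<lambda>_. p)) = p"
    using fin by (simp add: Pi_pmf_component)
  fix j assume j: "j \<in> I" "i \<noteq> j"
  have "I = insert i (I - {i})" using i by auto
  then have "map_pmf (\<lambda>C. (C i, C j)) (Pi_pmf I d (\<lambda>_. p))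
      = map_pmf (\<lambda>C. (C i, C j)) (Pi_pmf (insert i (I - {i})) d (\<lambda>_. p))" by simp
  also have "\<dots> = map_pmf (\<lambda>(y, f). (y, f j)) (pair_pmf p (Pi_pmf (I - {i}) d (\<lambda>_. p)))"
    using fin j by (subst Pi_pmf_insert) (auto simp: map_pmf_comp intro!: map_pmf_cong)
  also have "\<dots> = pair_pmf (map_pmf (\<lambda>y. y) p) (map_pmf (\<lambda>f. f j) (Pi_pmf (I - {i}) d (\<lambda>_. p)))"
    by (rule map_pair)
  also have "\<dots> = pair_pmf p p"
    using fin j by (simp add: Pi_pmf_component pmf.map_ident)
  finally show "map_pmf (\<lambda>C. (C i, C j)) (Pi_pmf I d (\<lambda>_. p)) = pair_pmf p p" .
qed

lemma finite_set_Pi_pmf: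
  assumes "finite I" "\<And>i. i \<in> I \<Longrightarrow> finite (set_pmf (p i))"
  shows "finite (set_pmf (Pi_pmf I d p))"
  using assms by (auto simp: set_Pi_pmf intro!: finite_PiE_dflt)

lemma pairwise_iid_subset: "pairwise_iid D I p \<Longrightarrow> J \<subseteq> I \<Longrightarrow> pairwise_iid D J p"
  by (meson pairwise_iid_def subsetD)

lemma expectation_pairwise_iid_component:
  fixes f :: "'a \<Rightarrow> real"
  assumes "pairwise_iid D I p" "i \<in> I"
  shows "measure_pmf.expectation D (\<lambda>C. f (C i)) = measure_pmf.expectation p f"
proof -
  have "measure_pmf.expectation D (\<lambda>C. f (C i)) = measure_pmf.expectation (map_pmf (\<lambda>C. C i) D) f" by simp
  also have "map_pmf (\<lambda>C. C i) D = p" using assms by (simp add: pairwise_iid_def)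
  finally show ?thesis .
qed

lemma expectation_pair_pmf_finite:
  fixes h :: "'a \<times> 'b \<Rightarrow> real"
  assumes "finite (set_pmf p)" "finite (set_pmf q)"
  shows "measure_pmf.expectation (pair_pmf p q) h
    = measure_pmf.expectation p (\<lambda>a. measure_pmf.expectation q (\<lambda>b. h (a, b)))"
  unfolding pair_pmf_def
  by (subst expectation_bind_pmf_finite) (use assms in \<open>auto simp: map_pmf_def[symmetric]\<close>)

lemma expectation_pairwise_iid_pair:
  fixes h :: "'a \<Rightarrow> 'a \<Rightarrow> real"
  assumes pw: "pairwise_iid D I p" "i \<in> I" "j \<in> I" "i \<noteq> j" and fin: "finite (set_pmf p)"
  shows "measure_pmf.expectation D (\<lambda>C. h (C i) (C j))
    = measure_pmf.expectation p (\<lambda>a. measure_pmf.expectation p (h a))"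
proof -
  have "measure_pmf.expectation D (\<lambda>C. h (C i) (C j))
     = measure_pmf.expectation (map_pmf (\<lambda>C. (C i, C j)) D) (\<lambda>(a, b). h a b)" by simp
  also have "map_pmf (\<lambda>C. (C i, C j)) D = pair_pmf p p"
    using pw by (simp add: pairwise_iid_def)
  finally show ?thesis by (simp add: expectation_pair_pmf_finite fin)
qed

text \<open>The centred values are pairwise uncorrelated, so the second moment of their sum is
  \<open>card A\<close> times one variance; the absolute deviation is at most the root of the
  squared one.\<close>

lemma pairwise_iid_average_deviation:
  fixes f :: "'a \<Rightarrow> real"
  assumes finD: "finite (set_pmf D)" and fin: "finite (set_pmf p)"
    and pw: "pairwise_iid D A p" and A: "finite A" "A \<noteq> {}"
  shows "measure_pmf.expectation D (\<lambda>C. \<bar>(\<Sum>i\<in>A. f (C i)) / card A - measure_pmf.expectation p f\<bar>)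
    \<le> sqrt (measure_pmf.expectation p (\<lambda>a. (f a)\<^sup>2) / card A)"
proof -
  define g where "g a = f a - measure_pmf.expectation p f" for a
  define v where "v = measure_pmf.expectation p (\<lambda>a. (g a)\<^sup>2)"
  have [simp]: "integrable p h" "integrable D h'" for h :: "'a \<Rightarrow> real" and h' :: "('b \<Rightarrow> 'a) \<Rightarrow> real"
    by (intro integrable_measure_pmf_finite; use fin finD in auto)+
  have card: "real (card A) > 0" using A by (simp add: card_gt_0_iff)
  have g0: "measure_pmf.expectation p g = 0" unfolding g_def by simp
  have "v = measure_pmf.variance p f" by (simp add: v_def g_def)
  also have "\<dots> \<le> measure_pmf.expectation p (\<lambda>a. (f a)\<^sup>2)"
    by (subst measure_pmf.variance_eq) auto
  finally have v: "v \<le> measure_pmf.expectation p (\<lambda>a. (f a)\<^sup>2)" .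
  have "measure_pmf.expectation D (\<lambda>C. (\<Sum>i\<in>A. g (C i))\<^sup>2)
      = (\<Sum>i\<in>A. \<Sum>j\<in>A. measure_pmf.expectation D (\<lambda>C. g (C i) * g (C j)))"
    by (simp add: power2_eq_square sum_product)
  also have "\<dots> = (\<Sum>i\<in>A. \<Sum>j\<in>A. if i = j then v else 0)"
  proof (intro sum.cong refl)
    fix i j assume "i \<in> A" "j \<in> A"
    then show "measure_pmf.expectation D (\<lambda>C. g (C i) * g (C j)) = (if i = j then v else 0)"
      using expectation_pairwise_iid_component[OF pw, of i "\<lambda>a. g a * g a"]
        expectation_pairwise_iid_pair[OF pw, of i j "\<lambda>a b. g a * g b"]
      by (auto simp: v_def power2_eq_square g0 fin)
  qed
  also have "\<dots> = card A * v" using A by simp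
  finally have sq: "measure_pmf.expectation D (\<lambda>C. (\<Sum>i\<in>A. g (C i))\<^sup>2) = card A * v" .
  have "measure_pmf.expectation D (\<lambda>C. \<bar>(\<Sum>i\<in>A. f (C i)) / card A - measure_pmf.expectation p f\<bar>)
      = measure_pmf.expectation D (\<lambda>C. \<bar>(\<Sum>i\<in>A. g (C i)) / card A\<bar>)"
    using card by (simp add: g_def sum_subtractf field_simps)
  also have "\<dots> \<le> sqrt (measure_pmf.expectation D (\<lambda>C. ((\<Sum>i\<in>A. g (C i)) / card A)\<^sup>2))"
    by (rule expectation_abs_le_sqrt[OF finD])
  also have "\<dots> = sqrt (v / card A)"
    using card by (simp add: power_divide sq) (simp add: power2_eq_square)
  also have "\<dots> \<le> sqrt (measure_pmf.expectation p (\<lambda>a. (f a)\<^sup>2) / card A)"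
    using card v by (simp add: divide_right_mono)
  finally show ?thesis .
qed

text \<open>The kernel is split at the level \<open>\<tau>\<close> of its likelihood ratio: the small part has a
  second moment of order \<open>\<tau>\<close>, and the large part only contributes its mean.\<close>
lemma soft_covering:
  fixes T :: "'a \<Rightarrow> 'z pmf"
  assumes finD: "finite (set_pmf D)" and fin: "finite (set_pmf p)" and finT: "\<And>u. finite (set_pmf (T u))"
    and pw: "pairwise_iid D A p" and A: "finite A" "A \<noteq> {}" and \<tau>: "0 \<le> \<tau>"
  defines "Q \<equiv> bind_pmf p T"
  shows "measure_pmf.expectation D (\<lambda>C. l1_dist (bind_pmf (pmf_of_set A) (\<lambda>i. T (C i))) Q)
    \<le> 2 * measure_pmf.prob (bind_pmf p (\<lambda>u. map_pmf (Pair u) (T u))) {(u, z). pmf (T u) z > \<tau> * pmf Q z}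
      + sqrt (\<tau> / card A)"
proof -
  have finQ: "finite (set_pmf Q)" using fin finT by (simp add: Q_def)
  have int[simp]: "integrable p h" "integrable D h'" for h :: "'a \<Rightarrow> real" and h' :: "('b \<Rightarrow> 'a) \<Rightarrow> real"
    by (intro integrable_measure_pmf_finite; use fin finD in auto)+
  define lo where "lo z u = (if pmf (T u) z > \<tau> * pmf Q z then 0 else pmf (T u) z)" for z u
  define hi where "hi z u = (if pmf (T u) z > \<tau> * pmf Q z then pmf (T u) z else 0)" for z u
  have lohi: "pmf (T u) z = lo z u + hi z u" for u z by (simp add: lo_def hi_def)
  have lo0: "0 \<le> lo z u" and hi0: "0 \<le> hi z u" for u z by (simp_all add: lo_def hi_def)
  have card: "real (card A) > 0" using A by (simp add: card_gt_0_iff)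
  have Qz: "pmf Q z = measure_pmf.expectation p (\<lambda>u. pmf (T u) z)" for z
    by (simp add: Q_def pmf_bind)
  define dev where "dev z C = \<bar>(\<Sum>i\<in>A. lo z (C i)) / card A - measure_pmf.expectation p (lo z)\<bar>"
    for z :: 'z and C :: "'b \<Rightarrow> 'a"
  \<comment> \<open>Codewords of positive probability stay in the support of \<open>p\<close>, so
    the mixture they induce lives on the support of \<open>Q\<close> and the distance is a sum over
    that set.\<close>
  have suppC: "set_pmf (bind_pmf (pmf_of_set A) (\<lambda>i. T (C i))) \<subseteq> set_pmf Q" if "C \<in> set_pmf D" for C
  proof -
    have "C i \<in> set_pmf p" if "i \<in> A" for i
    proof -
      have "C i \<in> set_pmf (map_pmf (\<lambda>C. C i) D)" using \<open>C \<in> set_pmf D\<close> by auto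
      then show ?thesis using pw that by (simp only: pairwise_iid_def)
    qed
    then show ?thesis using A by (auto simp: Q_def)
  qed
  have "measure_pmf.expectation D (\<lambda>C. l1_dist (bind_pmf (pmf_of_set A) (\<lambda>i. T (C i))) Q)
     \<le> measure_pmf.expectation D (\<lambda>C. \<Sum>z\<in>set_pmf Q. dev z C + (\<Sum>i\<in>A. hi z (C i)) / card A + measure_pmf.expectation p (hi z))"
  proof (rule expectation_mono_finite[OF finD])
    fix C assume C: "C \<in> set_pmf D"
    have "l1_dist (bind_pmf (pmf_of_set A) (\<lambda>i. T (C i))) Q
      = (\<Sum>z\<in>set_pmf Q. \<bar>(\<Sum>i\<in>A. pmf (T (C i)) z) / card A - pmf Q z\<bar>)"
      using suppC[OF C] by (subst l1_dist_eq_sum[OF finQ]) (auto simp: pmf_bind_pmf_of_set A)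
    also have "\<dots> \<le> (\<Sum>z\<in>set_pmf Q. dev z C + (\<Sum>i\<in>A. hi z (C i)) / card A + measure_pmf.expectation p (hi z))"
    proof (rule sum_mono)
      fix z
      have "0 \<le> (\<Sum>i\<in>A. hi z (C i)) / card A" "0 \<le> measure_pmf.expectation p (hi z)"
        by (auto intro!: sum_nonneg divide_nonneg_nonneg hi0 expectation_nonneg)
      then show "\<bar>(\<Sum>i\<in>A. pmf (T (C i)) z) / card A - pmf Q z\<bar>
          \<le> dev z C + (\<Sum>i\<in>A. hi z (C i)) / card A + measure_pmf.expectation p (hi z)"
        by (simp add: Qz lohi dev_def sum.distrib add_divide_distrib)
    qed
    finally show "l1_dist (bind_pmf (pmf_of_set A) (\<lambda>i. T (C i))) Q
      \<le> (\<Sum>z\<in>set_pmf Q. dev z C + (\<Sum>i\<in>A. hi z (C i)) / card A + measure_pmf.expectation p (hi z))" .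
  qed
  \<comment> \<open>The large part enters twice, as its codebook average and as the mean of that
    average; both have the same expectation, whence the factor \<open>2\<close>.\<close>
  also have "\<dots> = (\<Sum>z\<in>set_pmf Q. measure_pmf.expectation D (dev z)) + 2 * (\<Sum>z\<in>set_pmf Q. measure_pmf.expectation p (hi z))"
  proof -
    have "measure_pmf.expectation D (\<lambda>C. (\<Sum>i\<in>A. hi z (C i)) / card A) = measure_pmf.expectation p (hi z)" for z
      using expectation_pairwise_iid_component[OF pw, of _ "hi z"] card by simp
    then show ?thesis by (simp add: sum.distrib)
  qed
  also have "(\<Sum>z\<in>set_pmf Q. measure_pmf.expectation p (hi z))
     = measure_pmf.prob (bind_pmf p (\<lambda>u. map_pmf (Pair u) (T u))) {(u, z). pmf (T u) z > \<tau> * pmf Q z}"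
  proof -
    have "measure_pmf.prob (bind_pmf p (\<lambda>u. map_pmf (Pair u) (T u))) {(u, z). pmf (T u) z > \<tau> * pmf Q z}
      = measure_pmf.expectation p (\<lambda>u. \<Sum>z\<in>set_pmf Q. hi z u)"
      unfolding prob_bind_pmf
    proof (rule expectation_cong_pmf)
      fix u assume "u \<in> set_pmf p"
      then have sub: "set_pmf (T u) \<subseteq> set_pmf Q" by (auto simp: Q_def)
      have "measure_pmf.prob (map_pmf (Pair u) (T u)) {(u, z). pmf (T u) z > \<tau> * pmf Q z}
         = measure_pmf.expectation (T u) (indicator {z. pmf (T u) z > \<tau> * pmf Q z})"
        by (simp add: vimage_def)
      also have "\<dots> = (\<Sum>z\<in>set_pmf Q. hi z u)"
        using sub by (subst integral_measure_pmf[OF finQ]) (auto simp: hi_def indicator_def intro!: sum.cong)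
      finally show "measure_pmf.prob (map_pmf (Pair u) (T u)) {(u, z). pmf (T u) z > \<tau> * pmf Q z}
        = (\<Sum>z\<in>set_pmf Q. hi z u)" .
    qed
    then show ?thesis by simp
  qed
  also have "(\<Sum>z\<in>set_pmf Q. measure_pmf.expectation D (dev z)) \<le> (\<Sum>z\<in>set_pmf Q. pmf Q z * sqrt (\<tau> / card A))"
  proof (rule sum_mono)
    fix z
    have "measure_pmf.expectation D (dev z) \<le> sqrt (measure_pmf.expectation p (\<lambda>u. (lo z u)\<^sup>2) / card A)"
      unfolding dev_def by (rule pairwise_iid_average_deviation[OF finD fin pw A])
    \<comment> \<open>On the small part one factor of the square is at most
      \<open>\<tau> * pmf Q z\<close> and the other averages to \<open>pmf Q z\<close>. After the
      root a full factor \<open>pmf Q z\<close> remains, so the sum over \<open>z\<close> does not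
      bring in the alphabet size.\<close>
    also have "measure_pmf.expectation p (\<lambda>u. (lo z u)\<^sup>2) \<le> measure_pmf.expectation p (\<lambda>u. \<tau> * pmf Q z * pmf (T u) z)"
      using \<tau> by (intro expectation_mono_finite fin)
        (auto simp: lo_def power2_eq_square not_less intro!: mult_right_mono)
    also have "\<dots> = \<tau> * (pmf Q z)\<^sup>2" by (simp add: Qz power2_eq_square)
    finally show "measure_pmf.expectation D (dev z) \<le> pmf Q z * sqrt (\<tau> / card A)"
      by (simp add: divide_right_mono real_sqrt_mult real_sqrt_divide mult.commute)
  qed
  also have "\<dots> = sqrt (\<tau> / card A)"
    by (simp flip: sum_distrib_right add: sum_pmf_eq_1[OF finQ order_refl])
  finally show ?thesis by simp
qed

text \<open>Union bound over the rivals. A rival codeword \<open>v\<close> is independent of the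
  received word, which then has law \<open>Q\<close>; passing the test forces
  \<open>pmf Q y < pmf (T v) y / \<tau>\<close>, and the right side sums to at most
  \<open>1 / \<tau>\<close>. So each rival costs at most \<open>1 / \<tau>\<close>.\<close>

lemma packing:
  fixes T :: "'a \<Rightarrow> 'y pmf"
  assumes finD: "finite (set_pmf D)" and fin: "finite (set_pmf p)" and finT: "\<And>u. finite (set_pmf (T u))"
    and pw: "pairwise_iid D I p" and i: "i \<in> I" and J: "finite J" "J \<subseteq> I" "i \<notin> J" and \<tau>: "0 < \<tau>"
  defines "Q \<equiv> bind_pmf p T"
  defines "test \<equiv> \<lambda>u y. pmf (T u) y > \<tau> * pmf Q y"
  shows "measure_pmf.expectation D (\<lambda>C. measure_pmf.prob (T (C i)) {y. \<not> test (C i) y \<or> (\<exists>j\<in>J. test (C j) y)})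
    \<le> measure_pmf.prob (bind_pmf p (\<lambda>u. map_pmf (Pair u) (T u))) {(u, y). \<not> test u y} + card J / \<tau>"
proof -
  have finQ: "finite (set_pmf Q)" using fin finT by (simp add: Q_def)
  have int[simp]: "integrable p h" "integrable D h'" for h :: "'a \<Rightarrow> real" and h' :: "('b \<Rightarrow> 'a) \<Rightarrow> real"
    by (intro integrable_measure_pmf_finite; use fin finD in auto)+
  have "measure_pmf.expectation D (\<lambda>C. measure_pmf.prob (T (C i)) {y. \<not> test (C i) y \<or> (\<exists>j\<in>J. test (C j) y)})
     \<le> measure_pmf.expectation D (\<lambda>C. measure_pmf.prob (T (C i)) {y. \<not> test (C i) y}
          + (\<Sum>j\<in>J. measure_pmf.prob (T (C i)) {y. test (C j) y}))"
  proof (rule expectation_mono_finite[OF finD])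
    fix C
    have "{y. \<not> test (C i) y \<or> (\<exists>j\<in>J. test (C j) y)} = {y. \<not> test (C i) y} \<union> (\<Union>j\<in>J. {y. test (C j) y})"
      by auto
    then have "measure_pmf.prob (T (C i)) {y. \<not> test (C i) y \<or> (\<exists>j\<in>J. test (C j) y)}
      \<le> measure_pmf.prob (T (C i)) {y. \<not> test (C i) y} + measure_pmf.prob (T (C i)) (\<Union>j\<in>J. {y. test (C j) y})"
      by (simp add: measure_Un_le)
    also have "measure_pmf.prob (T (C i)) (\<Union>j\<in>J. {y. test (C j) y}) \<le> (\<Sum>j\<in>J. measure_pmf.prob (T (C i)) {y. test (C j) y})"
      using J by (intro measure_pmf.finite_measure_subadditive_finite) auto
    finally show "measure_pmf.prob (T (C i)) {y. \<not> test (C i) y \<or> (\<exists>j\<in>J. test (C j) y)}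
      \<le> measure_pmf.prob (T (C i)) {y. \<not> test (C i) y} + (\<Sum>j\<in>J. measure_pmf.prob (T (C i)) {y. test (C j) y})"
      by simp
  qed
  also have "\<dots> = measure_pmf.expectation D (\<lambda>C. measure_pmf.prob (T (C i)) {y. \<not> test (C i) y})
      + (\<Sum>j\<in>J. measure_pmf.expectation D (\<lambda>C. measure_pmf.prob (T (C i)) {y. test (C j) y}))"
    by simp
  also have "measure_pmf.expectation D (\<lambda>C. measure_pmf.prob (T (C i)) {y. \<not> test (C i) y})
     = measure_pmf.prob (bind_pmf p (\<lambda>u. map_pmf (Pair u) (T u))) {(u, y). \<not> test u y}"
    using expectation_pairwise_iid_component[OF pw i, of "\<lambda>u. measure_pmf.prob (T u) {y. \<not> test u y}"]
    by (simp add: prob_bind_pmf vimage_def)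
  also have "(\<Sum>j\<in>J. measure_pmf.expectation D (\<lambda>C. measure_pmf.prob (T (C i)) {y. test (C j) y})) \<le> (\<Sum>j\<in>J. 1 / \<tau>)"
  proof (rule sum_mono)
    fix j assume j: "j \<in> J"
    have "measure_pmf.expectation D (\<lambda>C. measure_pmf.prob (T (C i)) {y. test (C j) y})
      = measure_pmf.expectation p (\<lambda>v. measure_pmf.expectation p (\<lambda>u. measure_pmf.prob (T u) {y. test v y}))"
      using expectation_pairwise_iid_pair[OF pw, of j i "\<lambda>v u. measure_pmf.prob (T u) {y. test v y}"] i j J fin
      by auto
    also have "\<dots> = measure_pmf.expectation p (\<lambda>v. measure_pmf.prob Q {y. test v y})"
      by (simp add: Q_def prob_bind_pmf)
    also have "\<dots> = measure_pmf.expectation p (\<lambda>v. \<Sum>y\<in>set_pmf Q. pmf Q y * indicator {y. test v y} y)"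
      unfolding expectation_indicator_eq by (subst integral_measure_pmf[OF finQ]) auto
    finally have eq: "measure_pmf.expectation D (\<lambda>C. measure_pmf.prob (T (C i)) {y. test (C j) y})
      = measure_pmf.expectation p (\<lambda>v. \<Sum>y\<in>set_pmf Q. pmf Q y * indicator {y. test v y} y)" .
    have "measure_pmf.expectation p (\<lambda>v. \<Sum>y\<in>set_pmf Q. pmf Q y * indicator {y. test v y} y)
      \<le> measure_pmf.expectation p (\<lambda>v. \<Sum>y\<in>set_pmf Q. pmf (T v) y / \<tau>)"
    proof (intro expectation_mono_finite fin sum_mono)
      fix v y
      show "pmf Q y * indicator {y. test v y} y \<le> pmf (T v) y / \<tau>"
        using \<tau> by (auto simp: indicator_def test_def field_simps)
    qed
    also have "\<dots> = (\<Sum>y\<in>set_pmf Q. pmf Q y) / \<tau>"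
      by (simp add: Q_def pmf_bind sum_divide_distrib)
    also have "\<dots> = 1 / \<tau>" by (simp add: sum_pmf_eq_1[OF finQ order_refl])
    finally show "measure_pmf.expectation D (\<lambda>C. measure_pmf.prob (T (C i)) {y. test (C j) y}) \<le> 1 / \<tau>" by (simp only: eq)
  qed
  finally show ?thesis by simp
qed

subsection \<open>Information density and random codebooks\<close>

lemma mutual_info_eq_kl_div:
  assumes "finite (set_pmf P)"
  shows "ereal (mutual_info P) = kl_div P (pair_pmf (map_pmf fst P) (map_pmf snd P))"
proof -
  have "set_pmf P \<subseteq> set_pmf (pair_pmf (map_pmf fst P) (map_pmf snd P))" by force
  then show ?thesis
    by (auto simp: kl_div_def mutual_info_def pmf_pair case_prod_unfold simp flip: pmf_pair)
qed

text \<open>Makes \<open>R'\<close> nonnegative, as the size bound \<open>num_idx_le\<close>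
  requires.\<close>

lemma mutual_info_nonneg:
  assumes fin: "finite (set_pmf P)"
  shows "0 \<le> mutual_info P"
proof -
  let ?Q = "pair_pmf (map_pmf fst P) (map_pmf snd P)"
  have finQ: "finite (set_pmf ?Q)" using fin by simp
  have "0 \<le> kl_div P ?Q"
  proof (rule kl_div_nonneg[OF finQ])
    show "set_pmf P \<subseteq> set_pmf ?Q" by force
    show "0 < Min (pmf ?Q ` set_pmf ?Q)"
      using finQ by (subst Min_gr_iff) (auto simp: set_pmf_not_empty pmf_positive simp del: set_pair_pmf)
    show "Min (pmf ?Q ` set_pmf ?Q) \<le> pmf ?Q a" if "a \<in> set_pmf ?Q" for a
      using finQ that by (intro Min_le) auto
  qed
  then show ?thesis by (simp flip: mutual_info_eq_kl_div[OF fin])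
qed

lemma pmf_bind_map_Pair:
  "pmf (bind_pmf p (\<lambda>u. map_pmf (Pair u) (T u))) (u, z) = pmf p u * pmf (T u) z"
proof -
  have "pmf (map_pmf (Pair a) (T a)) (u, z) = pmf (T u) z * indicator {u} a" for a
  proof (cases "a = u")
    case True
    then show ?thesis using pmf_map_inj'[of "Pair u" "T u" z] by (simp add: inj_on_def)
  next
    case False
    then show ?thesis by (auto simp: pmf_eq_0_set_pmf)
  qed
  then show ?thesis by (simp add: pmf_bind measure_pmf_single mult.commute)
qed

text \<open>Exhibits mutual information as the mean of the information density, the form in which a
  Chernoff bound can use it.\<close>

lemma mutual_info_kernel:
  assumes finp: "finite (set_pmf p)" and finT: "\<And>u. finite (set_pmf (T u))"
  shows "mutual_info (bind_pmf p (\<lambda>u. map_pmf (Pair u) (T u)))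
    = measure_pmf.expectation (bind_pmf p (\<lambda>u. map_pmf (Pair u) (T u)))
        (\<lambda>(u, z). log 2 (pmf (T u) z / pmf (bind_pmf p T) z))"
proof -
  let ?J = "bind_pmf p (\<lambda>u. map_pmf (Pair u) (T u))"
  have fin: "finite (set_pmf ?J)" using finp finT by simp
  have fst: "map_pmf fst ?J = p" by (simp add: map_bind_pmf map_pmf_comp bind_return_pmf')
  have snd: "map_pmf snd ?J = bind_pmf p T" by (simp add: map_bind_pmf map_pmf_comp pmf.map_ident)
  have "measure_pmf.expectation ?J (\<lambda>(u, z). log 2 (pmf (T u) z / pmf (bind_pmf p T) z))
     = (\<Sum>uz\<in>set_pmf ?J. pmf ?J uz * (case uz of (u, z) \<Rightarrow> log 2 (pmf (T u) z / pmf (bind_pmf p T) z)))"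
    by (subst integral_measure_pmf[OF fin]) auto
  also have "\<dots> = mutual_info ?J"
    unfolding mutual_info_def fst snd
    by (intro sum.cong refl) (auto simp: pmf_bind_map_Pair set_pmf_eq)
  finally show ?thesis by simp
qed

text \<open>Turns a threshold on the block likelihood ratio into one on a sum of letterwise
  information densities. The support hypotheses keep every letterwise ratio positive, so that
  \<open>2 powr\<close> of its logarithm gives it back.\<close>

lemma likelihood_ratio_mem_chan:
  assumes "us \<in> set_pmf (iid_list n p)" "zs \<in> set_pmf (mem_chan T us)"
  shows "0 < pmf (iid_list n (bind_pmf p T)) zs \<and>
    pmf (mem_chan T us) zs = 2 powr (\<Sum>(u, z)\<leftarrow>zip us zs. log 2 (pmf (T u) z / pmf (bind_pmf p T) z))
      * pmf (iid_list n (bind_pmf p T)) zs"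
  using assms
proof (induction n arbitrary: us zs)
  case (Suc n)
  then obtain u us' z zs' where eq: "us = u # us'" "zs = z # zs'"
    and in': "u \<in> set_pmf p" "us' \<in> set_pmf (iid_list n p)" "z \<in> set_pmf (T u)" "zs' \<in> set_pmf (mem_chan T us')"
    by auto
  have "z \<in> set_pmf (bind_pmf p T)" using in' by auto
  then have pos: "0 < pmf (T u) z" "0 < pmf (bind_pmf p T) z"
    using in' by (auto intro: pmf_positive simp del: set_bind_pmf)
  show ?case
    using Suc.IH[OF in'(2,4)] pos
    by (simp add: eq pmf_iid_list_Cons pmf_mem_chan_Cons powr_add del: iid_list.simps mem_chan.simps)
qed simp

text \<open>Moves events from a pair of blocks to the i.i.d. list of letter pairs. The implication
  is asked on the support only, where \<open>likelihood_ratio_mem_chan\<close> is available.\<close>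

lemma prob_iid_pair_le:
  assumes finp: "finite (set_pmf p)" and finT: "\<And>u. finite (set_pmf (T u))"
    and sub: "\<And>us zs. us \<in> set_pmf (iid_list n p) \<Longrightarrow> zs \<in> set_pmf (mem_chan T us) \<Longrightarrow>
      (us, zs) \<in> A \<Longrightarrow> zip us zs \<in> B"
  shows "measure_pmf.prob (bind_pmf (iid_list n p) (\<lambda>us. map_pmf (Pair us) (mem_chan T us))) A
    \<le> measure_pmf.prob (iid_list n (bind_pmf p (\<lambda>u. map_pmf (Pair u) (T u)))) B"
  unfolding iid_list_zip_mem_chan[symmetric] prob_bind_pmf
proof (rule expectation_mono_finite)
  fix us assume us: "us \<in> set_pmf (iid_list n p)"
  show "measure_pmf.prob (map_pmf (Pair us) (mem_chan T us)) A \<le> measure_pmf.prob (map_pmf (zip us) (mem_chan T us)) B"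
    unfolding measure_map_pmf
    by (rule measure_pmf.finite_measure_mono_AE) (use sub[OF us] in \<open>auto simp: AE_measure_pmf_iff\<close>)
qed (use finp in simp)

lemma sum_list_diff_const:
  "(\<Sum>x\<leftarrow>xs. f x - r) = sum_list (map f xs) - real (length xs) * r"
  by (induction xs) (auto simp: algebra_simps)

text \<open>The information density has mean \<open>I\<close>, so subtracting \<open>r\<close>, with
  both signs reversed for the lower tail, leaves a summand of negative mean, to which
  \<open>chernoff_iid_list\<close> applies.\<close>

lemma
  fixes p :: "'u pmf" and T :: "'u \<Rightarrow> 'z pmf"
  assumes finp: "finite (set_pmf p)" and finT: "\<And>u. finite (set_pmf (T u))"
  defines "I \<equiv> mutual_info (bind_pmf p (\<lambda>u. map_pmf (Pair u) (T u)))"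
  shows information_density_upper_tail: "I < r \<Longrightarrow> \<exists>\<rho>. 0 \<le> \<rho> \<and> \<rho> < 1 \<and> (\<forall>n.
     measure_pmf.prob (bind_pmf (iid_list n p) (\<lambda>us. map_pmf (Pair us) (mem_chan T us)))
       {(us, zs). pmf (mem_chan T us) zs > 2 powr (n * r) * pmf (iid_list n (bind_pmf p T)) zs} \<le> \<rho> ^ n)"
    and information_density_lower_tail: "r < I \<Longrightarrow> \<exists>\<rho>. 0 \<le> \<rho> \<and> \<rho> < 1 \<and> (\<forall>n.
     measure_pmf.prob (bind_pmf (iid_list n p) (\<lambda>us. map_pmf (Pair us) (mem_chan T us)))
       {(us, zs). \<not> pmf (mem_chan T us) zs > 2 powr (n * r) * pmf (iid_list n (bind_pmf p T)) zs} \<le> \<rho> ^ n)"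
proof -
  let ?J = "bind_pmf p (\<lambda>u. map_pmf (Pair u) (T u))"
  define i where "i = (\<lambda>(u, z). log 2 (pmf (T u) z / pmf (bind_pmf p T) z))"
  have finJ: "finite (set_pmf ?J)" using finp finT by simp
  have int: "integrable ?J f" for f :: "'u \<times> 'z \<Rightarrow> real" by (rule integrable_measure_pmf_finite[OF finJ])
  have I: "measure_pmf.expectation ?J i = I"
    unfolding I_def i_def by (rule mutual_info_kernel[OF finp finT, symmetric])
  have event: "pmf (mem_chan T us) zs > 2 powr (n * r) * pmf (iid_list n (bind_pmf p T)) zs
      \<longleftrightarrow> n * r < sum_list (map i (zip us zs))"
    and len: "length (zip us zs) = n"
    if "us \<in> set_pmf (iid_list n p)" "zs \<in> set_pmf (mem_chan T us)" for n us zs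
    using likelihood_ratio_mem_chan[OF that] length_iid_list[OF that(1)] length_mem_chan[OF that(2)]
    by (auto simp: i_def)
  have neg: "(\<Sum>x\<leftarrow>xs. - i x) = - sum_list (map i xs)" for xs
    by (induction xs) auto
  {
    assume "I < r"
    then have "measure_pmf.expectation ?J (\<lambda>x. i x - r) < 0" by (simp add: int I)
    from chernoff_iid_list[OF finJ this] obtain \<rho> where \<rho>: "0 \<le> \<rho>" "\<rho> < 1"
      "\<And>n. measure_pmf.prob (iid_list n ?J) {xs. 0 \<le> (\<Sum>x\<leftarrow>xs. i x - r)} \<le> \<rho> ^ n" by auto
    show "\<exists>\<rho>. 0 \<le> \<rho> \<and> \<rho> < 1 \<and> (\<forall>n.
      measure_pmf.prob (bind_pmf (iid_list n p) (\<lambda>us. map_pmf (Pair us) (mem_chan T us)))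
       {(us, zs). pmf (mem_chan T us) zs > 2 powr (n * r) * pmf (iid_list n (bind_pmf p T)) zs} \<le> \<rho> ^ n)"
    proof (intro exI[of _ \<rho>] conjI allI \<rho>(1,2) order_trans[OF prob_iid_pair_le[OF finp finT] \<rho>(3)])
      fix n us zs assume *: "us \<in> set_pmf (iid_list n p)" "zs \<in> set_pmf (mem_chan T us)"
        "(us, zs) \<in> {(us, zs). pmf (mem_chan T us) zs > 2 powr (n * r) * pmf (iid_list n (bind_pmf p T)) zs}"
      show "zip us zs \<in> {xs. 0 \<le> (\<Sum>x\<leftarrow>xs. i x - r)}"
        using event[OF *(1,2)] len[OF *(1,2)] *(3) by (simp only: sum_list_diff_const) simp
    qed
  }
  {
    assume "r < I"
    then have "measure_pmf.expectation ?J (\<lambda>x. - i x - (-r)) < 0" by (simp add: int I)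
    from chernoff_iid_list[OF finJ this] obtain \<rho> where \<rho>: "0 \<le> \<rho>" "\<rho> < 1"
      "\<And>n. measure_pmf.prob (iid_list n ?J) {xs. 0 \<le> (\<Sum>x\<leftarrow>xs. - i x - (-r))} \<le> \<rho> ^ n" by auto
    show "\<exists>\<rho>. 0 \<le> \<rho> \<and> \<rho> < 1 \<and> (\<forall>n.
      measure_pmf.prob (bind_pmf (iid_list n p) (\<lambda>us. map_pmf (Pair us) (mem_chan T us)))
       {(us, zs). \<not> pmf (mem_chan T us) zs > 2 powr (n * r) * pmf (iid_list n (bind_pmf p T)) zs} \<le> \<rho> ^ n)"
    proof (intro exI[of _ \<rho>] conjI allI \<rho>(1,2) order_trans[OF prob_iid_pair_le[OF finp finT] \<rho>(3)])
      fix n us zs assume *: "us \<in> set_pmf (iid_list n p)" "zs \<in> set_pmf (mem_chan T us)"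
        "(us, zs) \<in> {(us, zs). \<not> pmf (mem_chan T us) zs > 2 powr (n * r) * pmf (iid_list n (bind_pmf p T)) zs}"
      show "zip us zs \<in> {xs. 0 \<le> (\<Sum>x\<leftarrow>xs. - i x - (-r))}"
        using event[OF *(1,2)] len[OF *(1,2)] *(3)
        by (simp only: sum_list_diff_const neg) simp
    qed
  }
qed

lemma expectation_swap_finite:
  fixes f :: "'a \<Rightarrow> 'b \<Rightarrow> real"
  assumes p: "finite (set_pmf p)" and q: "finite (set_pmf q)"
  shows "measure_pmf.expectation p (\<lambda>a. measure_pmf.expectation q (f a))
    = measure_pmf.expectation q (\<lambda>b. measure_pmf.expectation p (\<lambda>a. f a b))"
proof -
  have e: "measure_pmf.expectation p g = (\<Sum>a\<in>set_pmf p. pmf p a * g a)" for g :: "'a \<Rightarrow> real"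
    by (subst integral_measure_pmf[OF p]) auto
  have e': "measure_pmf.expectation q g = (\<Sum>a\<in>set_pmf q. pmf q a * g a)" for g :: "'b \<Rightarrow> real"
    by (subst integral_measure_pmf[OF q]) auto
  show ?thesis unfolding e e' sum_distrib_left
    by (subst sum.swap) (simp add: mult.left_commute)
qed

lemma expectation_le_const:
  fixes f :: "'a \<Rightarrow> real"
  assumes "finite (set_pmf p)" "\<And>a. a \<in> set_pmf p \<Longrightarrow> f a \<le> c"
  shows "measure_pmf.expectation p f \<le> c"
  using expectation_mono_finite[OF assms(1), of f "\<lambda>_. c"] assms(2) by simp

text \<open>Codewords are indexed by message, key and position within the bin of that pair.\<close>
definition idx :: "nat \<Rightarrow> nat \<Rightarrow> nat \<Rightarrow> (nat \<times> nat \<times> nat) set" where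
  "idx M K N = {1..M} \<times> {1..K} \<times> {1..N}"

text \<open>Only another message under the same key can mislead: the receiver knows the key, and a
  wrong position within the bin is no error.\<close>

definition rivals :: "nat \<Rightarrow> nat \<Rightarrow> nat \<times> nat \<times> nat \<Rightarrow> (nat \<times> nat \<times> nat) set" where
  "rivals M N i = ({1..M} - {fst i}) \<times> {fst (snd i)} \<times> {1..N}"

lemma card_rivals_le: "card (rivals M N i) \<le> M * N"
proof -
  have "card (rivals M N i) = card ({1..M} - {fst i}) * N"
    by (simp add: rivals_def card_cartesian_product)
  also have "\<dots> \<le> M * N"
    using card_mono[of "{1..M}" "{1..M} - {fst i}"] by (intro mult_right_mono) auto
  finally show ?thesis .
qed

definition lr_test :: "'a pmf \<Rightarrow> ('a \<Rightarrow> 'y pmf) \<Rightarrow> real \<Rightarrow> 'a \<Rightarrow> 'y \<Rightarrow> bool" where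
  "lr_test p T \<tau> u y \<longleftrightarrow> pmf (T u) y > \<tau> * pmf (bind_pmf p T) y"

definition kernel_pair :: "'a pmf \<Rightarrow> ('a \<Rightarrow> 'b pmf) \<Rightarrow> ('a \<times> 'b) pmf" where
  "kernel_pair p T = bind_pmf p (\<lambda>u. map_pmf (Pair u) (T u))"

text \<open>The distance is taken bin by bin and then averaged: a mixture over \<open>m\<close> and
  \<open>k\<close> would hide a dependence between the state and the pair
  \<open>(m, k)\<close>.\<close>

definition state_dist :: "'a pmf \<Rightarrow> ('a \<Rightarrow> 's pmf) \<Rightarrow> nat \<Rightarrow> nat \<Rightarrow> nat \<Rightarrow> (nat \<times> nat \<times> nat \<Rightarrow> 'a) \<Rightarrow> real" where
  "state_dist p V M K N C = measure_pmf.expectation (pmf_of_set ({1..M} \<times> {1..K}))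
     (\<lambda>(m, k). l1_dist (bind_pmf (pmf_of_set {1..N}) (\<lambda>l. V (C (m, k, l)))) (bind_pmf p V))"

text \<open>Unlike in \<open>state_dist\<close>, the mixture runs over all three indices, none of
  which the warden knows.\<close>

definition output_dist :: "'a pmf \<Rightarrow> ('a \<Rightarrow> 'z pmf) \<Rightarrow> nat \<Rightarrow> nat \<Rightarrow> nat \<Rightarrow> (nat \<times> nat \<times> nat \<Rightarrow> 'a) \<Rightarrow> real" where
  "output_dist p T M K N C = l1_dist (bind_pmf (pmf_of_set (idx M K N)) (\<lambda>i. T (C i))) (bind_pmf p T)"

definition decoding_error :: "'a pmf \<Rightarrow> ('a \<Rightarrow> 'y pmf) \<Rightarrow> real \<Rightarrow> nat \<Rightarrow> nat \<Rightarrow> nat \<Rightarrow> (nat \<times> nat \<times> nat \<Rightarrow> 'a) \<Rightarrow> real" where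
  "decoding_error p T \<tau> M K N C = measure_pmf.expectation (pmf_of_set (idx M K N))
     (\<lambda>i. measure_pmf.prob (T (C i)) {y. \<not> lr_test p T \<tau> (C i) y \<or> (\<exists>j\<in>rivals M N i. lr_test p T \<tau> (C j) y)})"

text \<open>The four expectations over a random codebook are bounded separately: soft covering
  within a bin, soft covering over all indices, packing, and the law of a single codeword. Selecting
  on the weighted sum then gives one codebook for all of them; \<open>\<phi>\<close> leaves room for
  the cost.\<close>

lemma exists_codebook:
  fixes p :: "'a pmf" and TS :: "'a \<Rightarrow> 's pmf" and TZ :: "'a \<Rightarrow> 'z pmf" and TY :: "'a \<Rightarrow> 'y pmf"
    and \<phi> :: "'a \<Rightarrow> real"
  assumes fin: "finite (set_pmf p)" "\<And>u. finite (set_pmf (TS u))" "\<And>u. finite (set_pmf (TZ u))"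
      "\<And>u. finite (set_pmf (TY u))"
    and pos: "M \<ge> 1" "K \<ge> 1" "N \<ge> 1" and \<tau>: "\<tau>S \<ge> 0" "\<tau>Z \<ge> 0" "\<tau>Y > 0" and c: "c \<ge> 0"
  shows "\<exists>C. (\<forall>i\<in>idx M K N. C i \<in> set_pmf p) \<and>
    c * state_dist p TS M K N C + c * output_dist p TZ M K N C + decoding_error p TY \<tau>Y M K N C
      + measure_pmf.expectation (pmf_of_set (idx M K N)) (\<lambda>i. \<phi> (C i))
    \<le> c * (2 * measure_pmf.prob (kernel_pair p TS) {(u, s). pmf (TS u) s > \<tau>S * pmf (bind_pmf p TS) s} + sqrt (\<tau>S / N))
      + c * (2 * measure_pmf.prob (kernel_pair p TZ) {(u, z). pmf (TZ u) z > \<tau>Z * pmf (bind_pmf p TZ) z} + sqrt (\<tau>Z / (M * K * N)))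
      + (measure_pmf.prob (kernel_pair p TY) {(u, y). \<not> pmf (TY u) y > \<tau>Y * pmf (bind_pmf p TY) y} + M * N / \<tau>Y)
      + measure_pmf.expectation p \<phi>"
proof -
  define I where "I = idx M K N"
  define D where "D = Pi_pmf I undefined (\<lambda>_. p)"
  have I: "finite I" "I \<noteq> {}" "card I = M * K * N"
    using pos by (auto simp: I_def idx_def card_cartesian_product)
  have finD: "finite (set_pmf D)" unfolding D_def by (rule finite_set_Pi_pmf) (use I fin in auto)
  have pw: "pairwise_iid D I p" unfolding D_def by (rule pairwise_iid_Pi_pmf[OF I(1)])
  have int[simp]: "integrable D h" for h :: "_ \<Rightarrow> real" by (rule integrable_measure_pmf_finite[OF finD])
  have finI: "finite (set_pmf (pmf_of_set I))" using I by simp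
  have MK: "finite (set_pmf (pmf_of_set ({1..M} \<times> {1..K})))" "{1..M} \<times> {1..K} \<noteq> {}" using pos by auto
  have S: "measure_pmf.expectation D (state_dist p TS M K N)
    \<le> 2 * measure_pmf.prob (kernel_pair p TS) {(u, s). pmf (TS u) s > \<tau>S * pmf (bind_pmf p TS) s} + sqrt (\<tau>S / N)"
    unfolding state_dist_def
  proof (subst expectation_swap_finite[OF finD MK(1)], rule expectation_le_const[OF MK(1)])
    fix mk assume "mk \<in> set_pmf (pmf_of_set ({1..M} \<times> {1..K}))"
    then obtain m k where mk: "mk = (m, k)" "m \<in> {1..M}" "k \<in> {1..K}" using MK(2) by (auto simp: set_pmf_of_set)
    \<comment> \<open>One bin as a set of indices; its codewords are still pairwise i.i.d., so soft
      covering applies with \<open>N\<close> codewords.\<close>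
    define A where "A = (\<lambda>l. (m, k, l)) ` {1..N}"
    have inj: "inj_on (\<lambda>l. (m, k, l)) {1..N}" by (auto simp: inj_on_def)
    have A: "finite A" "A \<noteq> {}" "A \<subseteq> I"
      using pos mk by (auto simp: A_def I_def idx_def)
    have cardA: "card A = N" unfolding A_def by (subst card_image[OF inj]) simp
    have "bind_pmf (pmf_of_set {1..N}) (\<lambda>l. TS (C (m, k, l))) = bind_pmf (pmf_of_set A) (\<lambda>i. TS (C i))" for C
      unfolding A_def using pos by (subst map_pmf_of_set_inj[OF inj, symmetric]) (auto simp: bind_map_pmf)
    then show "measure_pmf.expectation D (\<lambda>C. case mk of (m, k) \<Rightarrow>
          l1_dist (bind_pmf (pmf_of_set {1..N}) (\<lambda>l. TS (C (m, k, l)))) (bind_pmf p TS))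
        \<le> 2 * measure_pmf.prob (kernel_pair p TS) {(u, s). pmf (TS u) s > \<tau>S * pmf (bind_pmf p TS) s} + sqrt (\<tau>S / N)"
      using soft_covering[OF finD fin(1,2) pairwise_iid_subset[OF pw A(3)] A(1,2) \<tau>(1)] cardA
      by (simp add: mk kernel_pair_def)
  qed
  have Z: "measure_pmf.expectation D (output_dist p TZ M K N)
    \<le> 2 * measure_pmf.prob (kernel_pair p TZ) {(u, z). pmf (TZ u) z > \<tau>Z * pmf (bind_pmf p TZ) z} + sqrt (\<tau>Z / (M * K * N))"
    using soft_covering[OF finD fin(1,3) pw I(1,2) \<tau>(2)] I(3)
    by (simp add: output_dist_def[abs_def] kernel_pair_def I_def)
  have Y: "measure_pmf.expectation D (decoding_error p TY \<tau>Y M K N)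
    \<le> measure_pmf.prob (kernel_pair p TY) {(u, y). \<not> pmf (TY u) y > \<tau>Y * pmf (bind_pmf p TY) y} + M * N / \<tau>Y"
    unfolding decoding_error_def I_def[symmetric]
  proof (subst expectation_swap_finite[OF finD finI], rule expectation_le_const[OF finI])
    fix i assume "i \<in> set_pmf (pmf_of_set I)"
    then have i: "i \<in> I" using I by simp
    have J: "finite (rivals M N i)" "rivals M N i \<subseteq> I" "i \<notin> rivals M N i"
      using i by (auto simp: rivals_def I_def idx_def)
    have "measure_pmf.expectation D (\<lambda>C. measure_pmf.prob (TY (C i))
        {y. \<not> lr_test p TY \<tau>Y (C i) y \<or> (\<exists>j\<in>rivals M N i. lr_test p TY \<tau>Y (C j) y)})
      \<le> measure_pmf.prob (kernel_pair p TY) {(u, y). \<not> pmf (TY u) y > \<tau>Y * pmf (bind_pmf p TY) y} + card (rivals M N i) / \<tau>Y"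
      unfolding lr_test_def kernel_pair_def by (rule packing[OF finD fin(1,4) pw i J \<tau>(3)])
    also have "real (card (rivals M N i)) / \<tau>Y \<le> M * N / \<tau>Y"
    proof -
      have "real (card (rivals M N i)) \<le> real (M * N)" by (rule of_nat_mono[OF card_rivals_le])
      then show ?thesis using \<tau> by (intro divide_right_mono) auto
    qed
    finally show "measure_pmf.expectation D (\<lambda>C. measure_pmf.prob (TY (C i))
        {y. \<not> lr_test p TY \<tau>Y (C i) y \<or> (\<exists>j\<in>rivals M N i. lr_test p TY \<tau>Y (C j) y)})
      \<le> measure_pmf.prob (kernel_pair p TY) {(u, y). \<not> pmf (TY u) y > \<tau>Y * pmf (bind_pmf p TY) y} + M * N / \<tau>Y"
      by simp
  qed
  have \<Phi>: "measure_pmf.expectation D (\<lambda>C. measure_pmf.expectation (pmf_of_set I) (\<lambda>i. \<phi> (C i)))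
    \<le> measure_pmf.expectation p \<phi>"
    by (subst expectation_swap_finite[OF finD finI], rule expectation_le_const[OF finI])
      (use I expectation_pairwise_iid_component[OF pw, of _ \<phi>] in auto)
  define F where "F C = c * state_dist p TS M K N C + c * output_dist p TZ M K N C
    + decoding_error p TY \<tau>Y M K N C + measure_pmf.expectation (pmf_of_set I) (\<lambda>i. \<phi> (C i))" for C
  obtain C where C: "C \<in> set_pmf D" and le: "F C \<le> measure_pmf.expectation D F"
    using exists_le_expectation[OF finD, of F] by blast
  have "measure_pmf.expectation D F = c * measure_pmf.expectation D (state_dist p TS M K N)
     + c * measure_pmf.expectation D (output_dist p TZ M K N) + measure_pmf.expectation D (decoding_error p TY \<tau>Y M K N)
     + measure_pmf.expectation D (\<lambda>C. measure_pmf.expectation (pmf_of_set I) (\<lambda>i. \<phi> (C i)))"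
    by (simp add: F_def[abs_def])
  note le = order_trans[OF le, unfolded this,
    OF add_mono[OF add_mono[OF add_mono[OF mult_left_mono[OF S c] mult_left_mono[OF Z c]] Y] \<Phi>]]
  have "\<forall>i\<in>I. C i \<in> set_pmf p"
    using C I(1) by (auto simp: D_def set_Pi_pmf PiE_dflt_def)
  with le show ?thesis
    unfolding F_def I_def by (intro exI[of _ C] conjI) simp_all
qed

subsection \<open>The likelihood encoder\<close>

definition letter_kernel ::
  "('u \<Rightarrow> 's pmf) \<Rightarrow> ('s \<Rightarrow> 'x \<Rightarrow> 'o pmf) \<Rightarrow> ('u \<Rightarrow> 's \<Rightarrow> 'x) \<Rightarrow> 'u \<Rightarrow> ('s \<times> 'x \<times> 'o) pmf" where
  "letter_kernel V W xf u = bind_pmf (V u) (\<lambda>s. map_pmf (\<lambda>yz. (s, xf u s, yz)) (W s (xf u s)))"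

definition block_kernel ::
  "('u \<Rightarrow> 's pmf) \<Rightarrow> ('s \<Rightarrow> 'x \<Rightarrow> 'o pmf) \<Rightarrow> ('u \<Rightarrow> 's \<Rightarrow> 'x) \<Rightarrow> 'u list \<Rightarrow> ('s list \<times> 'x list \<times> 'o list) pmf" where
  "block_kernel V W xf us = map_pmf (\<lambda>t. (map fst t, map (fst \<circ> snd) t, map (snd \<circ> snd) t))
     (mem_chan (letter_kernel V W xf) us)"

lemma map_block_kernel_input:
  "map_pmf (\<lambda>(s, x, yz). x) (block_kernel V W xf us) = mem_chan (\<lambda>u. map_pmf (\<lambda>(s, x, yz). x) (letter_kernel V W xf u)) us"
  by (simp add: block_kernel_def map_pmf_comp flip: map_mem_chan) (simp add: comp_def case_prod_unfold)

lemma map_block_kernel_output: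
  "map_pmf (\<lambda>(s, x, yz). map f yz) (block_kernel V W xf us) = mem_chan (\<lambda>u. map_pmf (\<lambda>(s, x, yz). f yz) (letter_kernel V W xf u)) us"
  by (simp add: block_kernel_def map_pmf_comp flip: map_mem_chan) (simp add: comp_def case_prod_unfold)

text \<open>The encoder draws the input from its conditional law given the state sequence
  when the codeword is drawn from \<open>q\<close> first and the state is produced by the reverse kernel \<open>V\<close>.\<close>
lemma ex_likelihood_encoder:
  assumes len: "\<And>us. us \<in> set_pmf q \<Longrightarrow> length us = n"
  shows "\<exists>E. (\<forall>s. length s = n \<longrightarrow> set_pmf (E s) \<subseteq> {xs. length xs = n}) \<and>
    bind_pmf (bind_pmf q (mem_chan V)) (\<lambda>s. bind_pmf (E s) (\<lambda>x. map_pmf (\<lambda>yz. (s, x, yz)) (chan_list W (zip s x))))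
      = bind_pmf q (block_kernel V W xf)"
proof -
  \<comment> \<open>The codeword is averaged out: the channel sees only state and input, so the
    encoder need only reproduce their joint law.\<close>
  define J where "J = bind_pmf q (\<lambda>us. map_pmf (\<lambda>s. (s, map2 xf us s)) (mem_chan V us))"
  have fst: "map_pmf fst J = bind_pmf q (mem_chan V)"
    by (simp add: J_def map_bind_pmf map_pmf_comp pmf.map_ident)
  obtain K where K: "J = bind_pmf (map_pmf fst J) (\<lambda>s. map_pmf (Pair s) (K s))"
    using pmf_disintegration[of J] by blast
  \<comment> \<open>Off the support the disintegration says nothing about \<open>K\<close>; a
    constant word keeps the required length.\<close>
  define E where "E s = (if s \<in> set_pmf (map_pmf fst J) then K s else return_pmf (replicate n undefined))" for s
  have J: "J = bind_pmf (map_pmf fst J) (\<lambda>s. map_pmf (Pair s) (E s))"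
    by (subst K, rule bind_pmf_cong) (auto simp: E_def)
  have "length xs = n" if "s \<in> set_pmf (map_pmf fst J)" "xs \<in> set_pmf (K s)" for s xs
  proof -
    have "(s, xs) \<in> set_pmf J" using that by (subst K) auto
    then show ?thesis using len length_mem_chan by (fastforce simp: J_def)
  qed
  then have "\<forall>s. length s = n \<longrightarrow> set_pmf (E s) \<subseteq> {xs. length xs = n}"
    by (auto simp: E_def)
  moreover have "bind_pmf (map_pmf fst J) (\<lambda>s. bind_pmf (E s) (\<lambda>x. map_pmf (\<lambda>yz. (s, x, yz)) (chan_list W (zip s x))))
      = bind_pmf q (block_kernel V W xf)"
  proof -
    have "bind_pmf (map_pmf fst J) (\<lambda>s. bind_pmf (E s) (\<lambda>x. map_pmf (\<lambda>yz. (s, x, yz)) (chan_list W (zip s x))))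
      = bind_pmf (bind_pmf (map_pmf fst J) (\<lambda>s. map_pmf (Pair s) (E s)))
          (\<lambda>(s, x). map_pmf (\<lambda>yz. (s, x, yz)) (chan_list W (zip s x)))"
      by (simp add: bind_assoc_pmf bind_map_pmf)
    also have "\<dots> = bind_pmf J (\<lambda>(s, x). map_pmf (\<lambda>yz. (s, x, yz)) (chan_list W (zip s x)))"
      by (simp only: J[symmetric])
    also have "\<dots> = bind_pmf q (block_kernel V W xf)"
      by (simp add: J_def bind_assoc_pmf bind_map_pmf mem_chan_state_chan_list block_kernel_def[abs_def]
        letter_kernel_def[abs_def])
    finally show ?thesis .
  qed
  ultimately show ?thesis unfolding fst by blast
qed

section \<open>Index sets and the comparison of actual and ideal experiment\<close>

lemma pmf_of_set_Times:
  assumes "finite A" "A \<noteq> {}" "finite B" "B \<noteq> {}"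
  shows "pmf_of_set (A \<times> B) = pair_pmf (pmf_of_set A) (pmf_of_set B)"
proof (rule pmf_eqI)
  fix x :: "'a \<times> 'b"
  have "A \<times> B \<noteq> {}" "finite (A \<times> B)" using assms by auto
  with assms show "pmf (pmf_of_set (A \<times> B)) x = pmf (pair_pmf (pmf_of_set A) (pmf_of_set B)) x"
    by (cases x) (simp add: pmf_pair card_cartesian_product indicator_def)
qed

lemma num_idx_ge: "2 powr (n * R) \<le> num_idx n R"
  unfolding num_idx_def by linarith

lemma num_idx_pos: "1 \<le> num_idx n R"
proof -
  have "0 < real (num_idx n R)" using num_idx_ge[of n R] by (rule less_le_trans[rotated]) simp
  then show ?thesis by simp
qed

text \<open>The ceiling adds at most \<open>1\<close>, which is at most
  \<open>2 powr (n * R)\<close> for nonnegative \<open>R\<close>.\<close>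

lemma num_idx_le: "0 \<le> R \<Longrightarrow> num_idx n R \<le> 2 * 2 powr (n * R)"
proof -
  assume "0 \<le> R"
  then have "1 \<le> 2 powr (n * R)" by (simp add: ge_one_powr_ge_zero)
  then show ?thesis unfolding num_idx_def by linarith
qed

lemma num_idx_nonpos: "R \<le> 0 \<Longrightarrow> num_idx n R = 1"
proof -
  assume "R \<le> 0"
  then have "2 powr (n * R) \<le> 2 powr 0" by (intro powr_mono) (auto simp: mult_nonneg_nonpos)
  moreover have "0 < 2 powr (n * R)" by simp
  ultimately have "\<lceil>2 powr (n * R)\<rceil> = 1" by (intro ceiling_unique) auto
  then show ?thesis by (simp add: num_idx_def)
qed

definition ideal_joint where
  "ideal_joint V W xf M K N C = bind_pmf (pmf_of_set (idx M K N))
     (\<lambda>i. map_pmf (\<lambda>(s, x, yz). (fst i, fst (snd i), s, x, yz)) (block_kernel V W xf (C i)))"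

text \<open>Given \<open>(m, k)\<close>, both experiments apply the same kernel \<open>H\<close> to
  the state and differ in the law of the state alone: i.i.d. in the actual one, the mixture over the
  bin in the ideal one.\<close>

lemma ex_code_near_ideal:
  fixes V :: "'u \<Rightarrow> 's::finite pmf" and W :: "'s \<Rightarrow> 'x \<Rightarrow> ('y \<times> 'z) pmf"
  assumes PS: "bind_pmf p V = PS" and N: "N \<ge> 1"
    and C: "\<And>i. i \<in> idx (num_idx n R) (num_idx n RK) N \<Longrightarrow> C i \<in> set_pmf (iid_list n p)"
  shows "\<exists>enc. (\<forall>m k s. length s = n \<longrightarrow> set_pmf (enc m k s) \<subseteq> {xs. length xs = n}) \<and>
    (\<forall>F B. (\<forall>a. \<bar>F a :: real\<bar> \<le> B) \<longrightarrow>
      \<bar>measure_pmf.expectation (code_joint_nc n R RK PS W enc) F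
        - measure_pmf.expectation (ideal_joint V W xf (num_idx n R) (num_idx n RK) N C) F\<bar>
      \<le> B * state_dist (iid_list n p) (mem_chan V) (num_idx n R) (num_idx n RK) N C)"
proof -
  define M K where "M = num_idx n R" and "K = num_idx n RK"
  have pos: "M \<ge> 1" "K \<ge> 1" using num_idx_pos by (auto simp: M_def K_def)
  define q where "q m k = map_pmf (\<lambda>l. C (m, k, l)) (pmf_of_set {1..N})" for m k
  \<comment> \<open>The encoder is total in \<open>m\<close> and \<open>k\<close>, so outside the
    index ranges only the length condition is demanded.\<close>
  have ex: "\<exists>E. (\<forall>s. length s = n \<longrightarrow> set_pmf (E s) \<subseteq> {xs. length xs = n}) \<and>
    (m \<in> {1..M} \<and> k \<in> {1..K} \<longrightarrow>
     bind_pmf (bind_pmf (q m k) (mem_chan V)) (\<lambda>s. bind_pmf (E s) (\<lambda>x. map_pmf (\<lambda>yz. (s, x, yz)) (chan_list W (zip s x))))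
      = bind_pmf (q m k) (block_kernel V W xf))" for m k
  proof (cases "m \<in> {1..M} \<and> k \<in> {1..K}")
    case True
    have "length us = n" if "us \<in> set_pmf (q m k)" for us
      using that True N by (auto simp: q_def idx_def M_def K_def intro!: length_iid_list[OF C])
    then show ?thesis using ex_likelihood_encoder[of "q m k" n V W xf] by blast
  next
    case False
    then show ?thesis by (intro exI[of _ "\<lambda>_. return_pmf (replicate n undefined)"]) auto
  qed
  then obtain enc where len: "\<And>m k s. length s = n \<Longrightarrow> set_pmf (enc m k s) \<subseteq> {xs. length xs = n}"
    and enc: "\<And>m k. m \<in> {1..M} \<Longrightarrow> k \<in> {1..K} \<Longrightarrow>
      bind_pmf (bind_pmf (q m k) (mem_chan V)) (\<lambda>s. bind_pmf (enc m k s) (\<lambda>x. map_pmf (\<lambda>yz. (s, x, yz)) (chan_list W (zip s x))))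
      = bind_pmf (q m k) (block_kernel V W xf)"
  proof -
    define P where "P m k E \<longleftrightarrow> (\<forall>s. length s = n \<longrightarrow> set_pmf (E s) \<subseteq> {xs. length xs = n}) \<and>
      (m \<in> {1..M} \<and> k \<in> {1..K} \<longrightarrow>
       bind_pmf (bind_pmf (q m k) (mem_chan V)) (\<lambda>s. bind_pmf (E s) (\<lambda>x. map_pmf (\<lambda>yz. (s, x, yz)) (chan_list W (zip s x))))
        = bind_pmf (q m k) (block_kernel V W xf))" for m k E
    have "\<forall>m k. \<exists>E. P m k E" using ex unfolding P_def by blast
    then obtain enc where "\<And>m k. P m k (enc m k)" by metis
    then show ?thesis by (intro that[of enc]) (simp_all add: P_def)
  qed
  define U where "U = pmf_of_set ({1..M} \<times> {1..K})"
  have setU: "set_pmf U = {1..M} \<times> {1..K}" using pos unfolding U_def by (subst set_pmf_of_set) auto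
  have U: "U = pair_pmf (pmf_of_set {1..M}) (pmf_of_set {1..K})"
    unfolding U_def using pos by (subst pmf_of_set_Times) auto
  define H where "H = (\<lambda>(m :: nat, k :: nat). \<lambda>s. bind_pmf (enc m k s) (\<lambda>x. map_pmf (\<lambda>yz. (m, k, s, x, yz)) (chan_list W (zip s x))))"
  have code: "code_joint_nc n R RK PS W enc = bind_pmf U (\<lambda>mk. bind_pmf (iid_list n PS) (H mk))"
    by (simp add: code_joint_nc_def U pair_pmf_def bind_assoc_pmf bind_return_pmf H_def M_def K_def)
  have I: "pmf_of_set (idx M K N) = bind_pmf U (\<lambda>(m, k). map_pmf (\<lambda>l. (m, k, l)) (pmf_of_set {1..N}))"
    using pos N unfolding idx_def U
    by (subst pmf_of_set_Times) (auto simp: pmf_of_set_Times pair_pmf_def bind_assoc_pmf bind_return_pmf map_pmf_def)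
  have ideal: "ideal_joint V W xf M K N C = bind_pmf U (\<lambda>mk. bind_pmf (bind_pmf (q (fst mk) (snd mk)) (mem_chan V)) (H mk))"
  proof -
    have "ideal_joint V W xf M K N C = bind_pmf U (\<lambda>mk. map_pmf (\<lambda>(s, x, yz). (fst mk, snd mk, s, x, yz))
        (bind_pmf (q (fst mk) (snd mk)) (block_kernel V W xf)))"
      unfolding ideal_joint_def I
      by (simp add: bind_assoc_pmf bind_map_pmf map_bind_pmf q_def case_prod_unfold)
    also have "\<dots> = bind_pmf U (\<lambda>mk. bind_pmf (bind_pmf (q (fst mk) (snd mk)) (mem_chan V)) (H mk))"
    proof (rule bind_pmf_cong[OF refl])
      fix mk assume "mk \<in> set_pmf U"
      then have mk: "fst mk \<in> {1..M}" "snd mk \<in> {1..K}" by (auto simp: setU)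
      show "map_pmf (\<lambda>(s, x, yz). (fst mk, snd mk, s, x, yz)) (bind_pmf (q (fst mk) (snd mk)) (block_kernel V W xf))
        = bind_pmf (bind_pmf (q (fst mk) (snd mk)) (mem_chan V)) (H mk)"
        unfolding enc[OF mk, symmetric]
        by (simp add: map_bind_pmf map_pmf_comp H_def case_prod_unfold)
    qed
    finally show ?thesis .
  qed
  have "\<bar>measure_pmf.expectation (code_joint_nc n R RK PS W enc) F
        - measure_pmf.expectation (ideal_joint V W xf M K N C) F\<bar>
      \<le> B * state_dist (iid_list n p) (mem_chan V) M K N C" if F: "\<And>a. \<bar>F a :: real\<bar> \<le> B" for F B
  proof -
    \<comment> \<open>Conditional expectation of the test given the pair and the state; it inherits
      the bound \<open>B\<close>, so only the two state laws remain to be compared.\<close>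
    define h where "h mk s = measure_pmf.expectation (H mk s) F" for mk s
    define d where "d mk = l1_dist (bind_pmf (q (fst mk) (snd mk)) (mem_chan V)) (iid_list n PS)" for mk
    have finU: "finite (set_pmf U)" by (simp add: setU)
    have int: "integrable U f" for f :: "_ \<Rightarrow> real" by (rule integrable_measure_pmf_finite[OF finU])
    have "measure_pmf.expectation (code_joint_nc n R RK PS W enc) F
       - measure_pmf.expectation (ideal_joint V W xf M K N C) F
      = measure_pmf.expectation U (\<lambda>mk. measure_pmf.expectation (iid_list n PS) (h mk)
          - measure_pmf.expectation (bind_pmf (q (fst mk) (snd mk)) (mem_chan V)) (h mk))"
      unfolding code ideal h_def by (simp add: expectation_bind_pmf[OF F] int)
    also have "\<bar>\<dots>\<bar> \<le> measure_pmf.expectation U (\<lambda>mk. B * d mk)"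
    proof (rule order_trans[OF integral_abs_bound expectation_mono_finite[OF finU]])
      fix mk assume "mk \<in> set_pmf U"
      have "\<bar>measure_pmf.expectation (bind_pmf (q (fst mk) (snd mk)) (mem_chan V)) (h mk)
          - measure_pmf.expectation (iid_list n PS) (h mk)\<bar> \<le> B * d mk"
        unfolding d_def using N
        by (intro expectation_diff_le_l1_dist) (auto simp: h_def q_def intro!: abs_expectation_le F)
      then show "\<bar>measure_pmf.expectation (iid_list n PS) (h mk)
          - measure_pmf.expectation (bind_pmf (q (fst mk) (snd mk)) (mem_chan V)) (h mk)\<bar> \<le> B * d mk"
        by (simp add: abs_minus_commute)
    qed
    also have "\<dots> = B * state_dist (iid_list n p) (mem_chan V) M K N C"
      by (simp add: state_dist_def d_def U_def q_def bind_map_pmf iid_list_bind_mem_chan PS case_prod_unfold)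
    finally show ?thesis .
  qed
  then show ?thesis using len unfolding M_def K_def by blast
qed

subsection \<open>Decoding and costs\<close>

definition input_kernel where
  "input_kernel V W xf u = map_pmf (\<lambda>(s, x, yz). x) (letter_kernel V W xf u)"

definition receiver_kernel where
  "receiver_kernel V W xf u = map_pmf (\<lambda>(s, x, yz). fst yz) (letter_kernel V W xf u)"

definition warden_kernel where
  "warden_kernel V W xf u = map_pmf (\<lambda>(s, x, yz). snd yz) (letter_kernel V W xf u)"

lemma ideal_joint_input:
  "map_pmf (\<lambda>(m, k, s, x, yz). x) (ideal_joint V W xf M K N C)
    = bind_pmf (pmf_of_set (idx M K N)) (\<lambda>i. mem_chan (input_kernel V W xf) (C i))"
  unfolding input_kernel_def[abs_def] map_block_kernel_input[symmetric]
  by (simp add: ideal_joint_def map_bind_pmf map_pmf_comp case_prod_unfold)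

lemma ideal_joint_warden:
  "map_pmf (\<lambda>(m, k, s, x, yz). map snd yz) (ideal_joint V W xf M K N C)
    = bind_pmf (pmf_of_set (idx M K N)) (\<lambda>i. mem_chan (warden_kernel V W xf) (C i))"
  unfolding warden_kernel_def[abs_def] map_block_kernel_output[symmetric]
  by (simp add: ideal_joint_def map_bind_pmf map_pmf_comp case_prod_unfold)

lemma ideal_joint_receiver:
  "map_pmf (\<lambda>(m, k, s, x, yz). (m, k, map fst yz)) (ideal_joint V W xf M K N C)
    = bind_pmf (pmf_of_set (idx M K N)) (\<lambda>i. map_pmf (\<lambda>y. (fst i, fst (snd i), y)) (mem_chan (receiver_kernel V W xf) (C i)))"
  unfolding receiver_kernel_def[abs_def] map_block_kernel_output[symmetric]
  by (simp add: ideal_joint_def map_bind_pmf map_pmf_comp case_prod_unfold)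

section \<open>Average cost of i.i.d. inputs\<close>

lemma abs_avg_cost_le:
  assumes "\<And>x. \<bar>b x\<bar> \<le> B" "0 \<le> B"
  shows "\<bar>avg_cost b xs\<bar> \<le> B"
proof -
  have "\<bar>\<Sum>x\<leftarrow>xs. b x\<bar> \<le> length xs * B"
    using assms(1) by (induction xs) (auto simp: algebra_simps intro: order_trans[OF abs_triangle_ineq] add_mono)
  then show ?thesis
    using assms(2) by (cases "xs = []") (auto simp: avg_cost_def field_simps)
qed

lemma expectation_avg_cost_iid:
  assumes "finite (set_pmf p)" "n \<ge> 1"
  shows "measure_pmf.expectation (iid_list n p) (avg_cost b) = measure_pmf.expectation p b"
proof -
  have "measure_pmf.expectation (iid_list n p) (avg_cost b)
      = measure_pmf.expectation (iid_list n p) (\<lambda>xs. (\<Sum>x\<leftarrow>xs. b x) / n)"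
    by (rule expectation_cong_pmf) (auto simp: avg_cost_def dest: length_iid_list)
  then show ?thesis using assms by (simp add: expectation_sum_list_iid)
qed

lemma expectation_avg_cost_deviation:
  fixes p :: "'x pmf" and b :: "'x \<Rightarrow> real"
  assumes fin: "finite (set_pmf p)" and n: "n \<ge> 1"
  defines "\<mu> \<equiv> measure_pmf.expectation p b"
  shows "measure_pmf.expectation (iid_list n p) (\<lambda>xs. (avg_cost b xs - \<mu>)\<^sup>2)
    = measure_pmf.expectation p (\<lambda>x. (b x - \<mu>)\<^sup>2) / n"
proof -
  have g0: "measure_pmf.expectation p (\<lambda>x. b x - \<mu>) = 0"
    by (simp add: \<mu>_def integrable_measure_pmf_finite[OF fin])
  have "measure_pmf.expectation (iid_list n p) (\<lambda>xs. (avg_cost b xs - \<mu>)\<^sup>2)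
     = measure_pmf.expectation (iid_list n p) (\<lambda>xs. (\<Sum>x\<leftarrow>xs. b x - \<mu>)\<^sup>2 / (real n)\<^sup>2)"
  proof (rule expectation_cong_pmf)
    fix xs assume "xs \<in> set_pmf (iid_list n p)"
    then have "length xs = n" by (rule length_iid_list)
    then have "avg_cost b xs - \<mu> = (\<Sum>x\<leftarrow>xs. b x - \<mu>) / n"
      using n by (simp add: avg_cost_def sum_list_diff_const field_simps)
    then show "(avg_cost b xs - \<mu>)\<^sup>2 = (\<Sum>x\<leftarrow>xs. b x - \<mu>)\<^sup>2 / (real n)\<^sup>2" by (simp add: power_divide)
  qed
  also have "\<dots> = measure_pmf.expectation p (\<lambda>x. (b x - \<mu>)\<^sup>2) / n"
    using n by (simp add: expectation_square_sum_list_iid[OF fin g0]) (simp add: power2_eq_square)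
  finally show ?thesis .
qed

text \<open>Keeps the relative entropy finite: with a full reference law every word of length
  \<open>n\<close> is possible, and the code outputs only such words.\<close>

lemma code_warden_support:
  assumes len: "\<And>m k s. length s = n \<Longrightarrow> set_pmf (enc m k s) \<subseteq> {xs. length xs = n}"
    and full: "set_pmf Q = UNIV"
  shows "set_pmf (map_pmf (\<lambda>(m, k, s, x, yz). map snd yz) (code_joint_nc n R RK PS W enc)) \<subseteq> set_pmf (iid_list n Q)"
proof
  fix zs assume "zs \<in> set_pmf (map_pmf (\<lambda>(m, k, s, x, yz). map snd yz) (code_joint_nc n R RK PS W enc))"
  then obtain m k s x yz where "s \<in> set_pmf (iid_list n PS)" "x \<in> set_pmf (enc m k s)"
    "yz \<in> set_pmf (chan_list W (zip s x))" "zs = map snd yz"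
    by (auto simp: code_joint_nc_def)
  then have "length zs = n"
    using len[of s m k] by (force simp: chan_list_eq_mem_chan dest!: length_iid_list length_mem_chan)
  then show "zs \<in> set_pmf (iid_list n Q)" by (rule set_iid_list_full[OF full])
qed

text \<open>Any position in the bin is accepted. The choice is arbitrary when no message or several
  messages pass, and \<open>decoding_error\<close> already counts these events.\<close>

definition lr_decoder ::
  "'a pmf \<Rightarrow> ('a \<Rightarrow> 'y pmf) \<Rightarrow> real \<Rightarrow> nat \<Rightarrow> nat \<Rightarrow> (nat \<times> nat \<times> nat \<Rightarrow> 'a) \<Rightarrow> 'y \<Rightarrow> nat \<Rightarrow> nat" where
  "lr_decoder p T \<tau> M N C y k = (SOME m. m \<in> {1..M} \<and> (\<exists>l\<in>{1..N}. lr_test p T \<tau> (C (m, k, l)) y))"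

lemma lr_decoder_correct:
  assumes i: "i \<in> idx M K N" and "lr_test p T \<tau> (C i) y"
    and rivals: "\<And>j. j \<in> rivals M N i \<Longrightarrow> \<not> lr_test p T \<tau> (C j) y"
  shows "lr_decoder p T \<tau> M N C y (fst (snd i)) = fst i"
  unfolding lr_decoder_def
proof (rule some_equality)
  show "fst i \<in> {1..M} \<and> (\<exists>l\<in>{1..N}. lr_test p T \<tau> (C (fst i, fst (snd i), l)) y)"
    using assms by (auto simp: idx_def)
  fix m assume m: "m \<in> {1..M} \<and> (\<exists>l\<in>{1..N}. lr_test p T \<tau> (C (m, fst (snd i), l)) y)"
  then obtain l where l: "l \<in> {1..N}" "lr_test p T \<tau> (C (m, fst (snd i), l)) y" by blast
  show "m = fst i"
  proof (rule ccontr)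
    assume "m \<noteq> fst i"
    with m l(1) have "(m, fst (snd i), l) \<in> rivals M N i" by (auto simp: rivals_def)
    from rivals[OF this] l(2) show False by blast
  qed
qed

lemma decoding_error_ge:
  assumes "M \<ge> 1" "K \<ge> 1" "N \<ge> 1"
  shows "measure_pmf.prob (bind_pmf (pmf_of_set (idx M K N)) (\<lambda>i. map_pmf (\<lambda>y. (fst i, fst (snd i), y)) (T (C i))))
      {(m, k, y). lr_decoder p T \<tau> M N C y k \<noteq> m} \<le> decoding_error p T \<tau> M K N C"
proof -
  have I: "finite (idx M K N)" "idx M K N \<noteq> {}" using assms by (auto simp: idx_def)
  show ?thesis
    unfolding decoding_error_def prob_bind_pmf
  proof (rule expectation_mono_finite)
    fix i assume "i \<in> set_pmf (pmf_of_set (idx M K N))"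
    then have i: "i \<in> idx M K N" using I by simp
    show "measure_pmf.prob (map_pmf (\<lambda>y. (fst i, fst (snd i), y)) (T (C i))) {(m, k, y). lr_decoder p T \<tau> M N C y k \<noteq> m}
      \<le> measure_pmf.prob (T (C i)) {y. \<not> lr_test p T \<tau> (C i) y \<or> (\<exists>j\<in>rivals M N i. lr_test p T \<tau> (C j) y)}"
      unfolding measure_map_pmf
    proof (rule measure_pmf.finite_measure_mono)
      show "(\<lambda>y. (fst i, fst (snd i), y)) -` {(m, k, y). lr_decoder p T \<tau> M N C y k \<noteq> m}
        \<subseteq> {y. \<not> lr_test p T \<tau> (C i) y \<or> (\<exists>j\<in>rivals M N i. lr_test p T \<tau> (C j) y)}"
      proof (rule subsetI, rule ccontr)
        fix y assume y: "y \<in> (\<lambda>y. (fst i, fst (snd i), y)) -` {(m, k, y). lr_decoder p T \<tau> M N C y k \<noteq> m}"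
          and "y \<notin> {y. \<not> lr_test p T \<tau> (C i) y \<or> (\<exists>j\<in>rivals M N i. lr_test p T \<tau> (C j) y)}"
        then have "lr_decoder p T \<tau> M N C y (fst (snd i)) = fst i"
          by (intro lr_decoder_correct[OF i]) blast+
        with y show False by simp
      qed
    qed simp
  qed (use I in simp)
qed

text \<open>Also serves the case of a nonpositive right side in the theorem, where only rates below
  it are needed. The bin is replaced by the full product law \<open>iid_list n p\<close>, so the
  likelihood encoder works without covering error.\<close>

lemma achievable_nonpos_rate:
  fixes PS :: "'s::finite pmf" and W :: "'s \<Rightarrow> 'x::finite \<Rightarrow> ('y::finite \<times> 'z::finite) pmf"
    and p :: "'u::finite pmf"
  assumes R: "R \<le> 0" and B: "0 \<le> B"
    and PS: "bind_pmf p V = PS" and PZ: "bind_pmf p (warden_kernel V W xf) = Q0 PS W x0"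
    and cost: "measure_pmf.expectation (bind_pmf p (input_kernel V W xf)) b \<le> B"
  shows "achievable_nc PS W x0 b RK B R"
proof -
  define P where "P n E \<longleftrightarrow> (\<forall>s. length s = n \<longrightarrow> set_pmf (E s) \<subseteq> {xs. length xs = n}) \<and>
    bind_pmf (iid_list n PS) (\<lambda>s. bind_pmf (E s) (\<lambda>x. map_pmf (\<lambda>yz. (s, x, yz)) (chan_list W (zip s x))))
      = bind_pmf (iid_list n p) (block_kernel V W xf)" for n E
  have "\<exists>E. P n E" for n
    unfolding P_def PS[symmetric] iid_list_bind_mem_chan[symmetric]
    by (rule ex_likelihood_encoder) (rule length_iid_list)
  then obtain E where "\<And>n. P n (E n)" by metis
  then have len: "\<And>n s. length s = n \<Longrightarrow> set_pmf (E n s) \<subseteq> {xs. length xs = n}"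
    and E: "\<And>n. bind_pmf (iid_list n PS) (\<lambda>s. bind_pmf (E n s) (\<lambda>x. map_pmf (\<lambda>yz. (s, x, yz)) (chan_list W (zip s x))))
      = bind_pmf (iid_list n p) (block_kernel V W xf)"
    unfolding P_def by blast+
  define code where "code n = code_joint_nc n R RK PS W (\<lambda>m k. E n)" for n
  have M: "pmf_of_set {1..num_idx n R} = return_pmf 1" for n
    by (simp add: num_idx_nonpos[OF R] pmf_of_set_singleton)
  have code: "code n = bind_pmf (pmf_of_set {1..num_idx n RK}) (\<lambda>k. map_pmf (\<lambda>(s, x, yz). (1, k, s, x, yz))
      (bind_pmf (iid_list n p) (block_kernel V W xf)))" for n
    unfolding E[symmetric] code_def code_joint_nc_def M
    by (simp add: bind_return_pmf map_bind_pmf map_pmf_comp)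
  have X: "map_pmf (\<lambda>(m, k, s, x, yz). x) (code n) = iid_list n (bind_pmf p (input_kernel V W xf))" for n
    unfolding iid_list_bind_mem_chan[symmetric] input_kernel_def[abs_def] map_block_kernel_input[symmetric]
    by (simp add: code map_bind_pmf map_pmf_comp case_prod_unfold)
  have Z: "map_pmf (\<lambda>(m, k, s, x, yz). map snd yz) (code n) = iid_list n (Q0 PS W x0)" for n
    unfolding PZ[symmetric] iid_list_bind_mem_chan[symmetric] warden_kernel_def[abs_def] map_block_kernel_output[symmetric]
    by (simp add: code map_bind_pmf map_pmf_comp case_prod_unfold)
  have "measure_pmf.expectation (code n) (\<lambda>(m, k, s, x, yz). avg_cost b x) \<le> B" for n
  proof -
    have "measure_pmf.expectation (code n) (\<lambda>(m, k, s, x, yz). avg_cost b x)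
      = measure_pmf.expectation (map_pmf (\<lambda>(m, k, s, x, yz). x) (code n)) (avg_cost b)"
      by (simp add: case_prod_unfold)
    also have "\<dots> \<le> B"
      \<comment> \<open>For \<open>n = 0\<close> the average cost is \<open>0 / 0 = 0\<close>, which
        is where \<open>0 \<le> B\<close> enters.\<close>
      unfolding X using cost B
      by (cases "n = 0") (auto simp: expectation_avg_cost_iid avg_cost_def)
    finally show ?thesis .
  qed
  then have "limsup (\<lambda>n. ereal (measure_pmf.expectation (code n) (\<lambda>(m, k, s, x, yz). avg_cost b x))) \<le> ereal B"
    by (intro Limsup_bounded) auto
  moreover have "measure_pmf.prob (code n) {(m, k, s, x, yz). (1 :: nat) \<noteq> m} = 0" for n
    by (subst measure_pmf_zero_iff) (auto simp: code)
  moreover have "kl_div (iid_list n (Q0 PS W x0)) (iid_list n (Q0 PS W x0)) = 0" for n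
    by (auto simp: kl_div_def set_pmf_eq intro!: sum.neutral)
  ultimately show ?thesis
    unfolding achievable_nc_def
    by (intro exI[of _ "\<lambda>n m k. E n"] exI[of _ "\<lambda>_ _ _. 1"]) (auto simp: len Z simp flip: code_def dest: subsetD[OF len])
qed

lemma sqrt_rate_ratio_le:
  assumes "2 powr (real n * S) \<le> N"
  shows "sqrt (2 powr (real n * r) / N) \<le> (2 powr ((r - S) / 2)) ^ n"
proof -
  have pos: "0 < 2 powr (real n * S)" by simp
  with assms have "0 < N" by linarith
  with pos have "2 powr (real n * r) / N \<le> 2 powr (real n * r) / 2 powr (real n * S)"
    using assms by (intro divide_left_mono mult_pos_pos) auto
  also have "\<dots> = (2 powr (real n * ((r - S) / 2)))\<^sup>2"
    by (simp add: powr_diff[symmetric] power2_eq_square powr_add[symmetric] algebra_simps)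
  finally have "sqrt (2 powr (real n * r) / N) \<le> sqrt ((2 powr (real n * ((r - S) / 2)))\<^sup>2)"
    by (rule real_sqrt_le_mono)
  also have "\<dots> = 2 powr (real n * ((r - S) / 2))"
    by (rule real_sqrt_unique) auto
  also have "\<dots> = (2 powr ((r - S) / 2)) ^ n"
    by (simp add: powr_realpow[symmetric] powr_powr mult.commute)
  finally show ?thesis .
qed

text \<open>Arithmetic-geometric inequality with weight \<open>sqrt n\<close>, which balances the
  two terms when the square has mean of order \<open>1 / n\<close>.\<close>

lemma deviation_le_square:
  fixes a :: real
  assumes "n > 0"
  shows "a \<le> 1 / sqrt n + sqrt n * a\<^sup>2"
proof -
  have s: "sqrt n > 0" using assms by simp
  have "0 \<le> (1 - sqrt n * a)\<^sup>2 + sqrt n * a * (sqrt n * a) + 1" by (intro add_nonneg_nonneg) (auto simp flip: power2_eq_square)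
  then have "2 * (sqrt n * a) \<le> 2 * (1 + (sqrt n * a)\<^sup>2)" by (simp add: power2_eq_square algebra_simps)
  then show ?thesis using s by (simp add: field_simps power2_eq_square)
qed

subsection \<open>Codes of a fixed length\<close>

lemma state_dist_nonneg: "0 \<le> state_dist p V M K N C"
  unfolding state_dist_def by (rule expectation_nonneg) (auto simp: l1_dist_nonneg)

lemma decoding_error_nonneg: "0 \<le> decoding_error p T \<tau> M K N C"
  unfolding decoding_error_def by (rule expectation_nonneg) simp

text \<open>In the bound \<open>e\<close> the two distances carry the weight \<open>n\<close>: this absorbs the factor of order \<open>n\<close>
  by which the relative entropy may exceed the total variation.\<close>
lemma ex_code_of_length:
  fixes PS :: "'s::finite pmf" and W :: "'s \<Rightarrow> 'x::finite \<Rightarrow> ('y::finite \<times> 'z::finite) pmf"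
    and p :: "'u::finite pmf" and V :: "'u \<Rightarrow> 's pmf" and xf :: "'u \<Rightarrow> 's \<Rightarrow> 'x" and n :: nat
    and R RK R' :: real and b :: "'x \<Rightarrow> real"
  defines "TX \<equiv> input_kernel V W xf" and "TY \<equiv> receiver_kernel V W xf" and "TZ \<equiv> warden_kernel V W xf"
    and "M \<equiv> num_idx n R" and "K \<equiv> num_idx n RK" and "N \<equiv> num_idx n R'"
  defines "\<mu> \<equiv> measure_pmf.expectation (bind_pmf p TX) b"
  assumes n: "n \<ge> 1" and PS: "bind_pmf p V = PS" and Q: "bind_pmf p TZ = Q"
    and q: "0 < q" "\<And>z. q \<le> pmf Q z"
    and b: "\<And>x. \<bar>b x\<bar> \<le> bm"
    and \<tau>: "\<tau>S \<ge> 0" "\<tau>Z \<ge> 0" "\<tau>Y > 0"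
    and e: "n * (2 * measure_pmf.prob (kernel_pair (iid_list n p) (mem_chan V))
          {(us, s). pmf (mem_chan V us) s > \<tau>S * pmf (iid_list n (bind_pmf p V)) s} + sqrt (\<tau>S / N))
      + n * (2 * measure_pmf.prob (kernel_pair (iid_list n p) (mem_chan TZ))
          {(us, z). pmf (mem_chan TZ us) z > \<tau>Z * pmf (iid_list n (bind_pmf p TZ)) z} + sqrt (\<tau>Z / (M * K * N)))
      + (measure_pmf.prob (kernel_pair (iid_list n p) (mem_chan TY))
          {(us, y). \<not> pmf (mem_chan TY us) y > \<tau>Y * pmf (iid_list n (bind_pmf p TY)) y} + M * N / \<tau>Y)
      + measure_pmf.expectation (bind_pmf p TX) (\<lambda>x. (b x - \<mu>)\<^sup>2) / sqrt n \<le> e"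
  shows "\<exists>enc dec. (\<forall>m k s. length s = n \<longrightarrow> set_pmf (enc m k s) \<subseteq> {xs. length xs = n}) \<and>
    measure_pmf.expectation (code_joint_nc n R RK PS W enc) (\<lambda>(m, k, s, x, yz). avg_cost b x)
      \<le> \<mu> + 1 / sqrt n + (1 + bm) * e \<and>
    measure_pmf.prob (code_joint_nc n R RK PS W enc) {(m, k, s, x, yz). dec (map fst yz) k \<noteq> m} \<le> 2 * e \<and>
    0 \<le> kl_div (map_pmf (\<lambda>(m, k, s, x, yz). map snd yz) (code_joint_nc n R RK PS W enc)) (iid_list n Q) \<and>
    kl_div (map_pmf (\<lambda>(m, k, s, x, yz). map snd yz) (code_joint_nc n R RK PS W enc)) (iid_list n Q)
      \<le> ereal ((1 + ln (1 / q)) / ln 2 * e)"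
proof -
  have pos: "M \<ge> 1" "K \<ge> 1" "N \<ge> 1" using num_idx_pos by (auto simp: M_def K_def N_def)
  have n0: "real n > 0" "real n \<ge> 1" using n by auto
  have bm: "0 \<le> bm" using b[of undefined] by linarith
  \<comment> \<open>The mean squared cost deviation is of order \<open>1 / n\<close>, so the factor
    \<open>sqrt n\<close> required by \<open>deviation_le_square\<close> is affordable.\<close>
  define \<phi> where "\<phi> us = sqrt n * measure_pmf.expectation (mem_chan TX us) (\<lambda>xs. (avg_cost b xs - \<mu>)\<^sup>2)" for us
  have \<phi>0: "0 \<le> \<phi> us" for us by (simp add: \<phi>_def expectation_nonneg)
  have E\<phi>: "measure_pmf.expectation (iid_list n p) \<phi>
      = measure_pmf.expectation (bind_pmf p TX) (\<lambda>x. (b x - \<mu>)\<^sup>2) / sqrt n"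
  proof -
    have "measure_pmf.expectation (iid_list n p) \<phi>
      = sqrt n * measure_pmf.expectation (bind_pmf (iid_list n p) (mem_chan TX)) (\<lambda>xs. (avg_cost b xs - \<mu>)\<^sup>2)"
      unfolding \<phi>_def by (subst expectation_bind_pmf_finite) auto
    also have "\<dots> = sqrt n * (measure_pmf.expectation (bind_pmf p TX) (\<lambda>x. (b x - \<mu>)\<^sup>2) / n)"
      unfolding iid_list_bind_mem_chan \<mu>_def by (subst expectation_avg_cost_deviation) (use n in auto)
    finally have "measure_pmf.expectation (iid_list n p) \<phi>
      = sqrt n / n * measure_pmf.expectation (bind_pmf p TX) (\<lambda>x. (b x - \<mu>)\<^sup>2)" by simp
    moreover have "sqrt n / n = inverse (sqrt n)" by (rule sqrt_divide_self_eq) simp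
    ultimately show ?thesis by (simp add: divide_inverse mult.commute)
  qed
  obtain C where C: "\<And>i. i \<in> idx M K N \<Longrightarrow> C i \<in> set_pmf (iid_list n p)"
    and le: "n * state_dist (iid_list n p) (mem_chan V) M K N C + n * output_dist (iid_list n p) (mem_chan TZ) M K N C
      + decoding_error (iid_list n p) (mem_chan TY) \<tau>Y M K N C
      + measure_pmf.expectation (pmf_of_set (idx M K N)) (\<lambda>i. \<phi> (C i)) \<le> e"
    using exists_codebook[of "iid_list n p" "mem_chan V" "mem_chan TZ" "mem_chan TY" M K N \<tau>S \<tau>Z \<tau>Y "real n" \<phi>]
      pos \<tau> e by (force simp: E\<phi> iid_list_bind_mem_chan)
  define \<Delta> where "\<Delta> = state_dist (iid_list n p) (mem_chan V) M K N C"
  define Zd where "Zd = output_dist (iid_list n p) (mem_chan TZ) M K N C"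
  define Er where "Er = decoding_error (iid_list n p) (mem_chan TY) \<tau>Y M K N C"
  define Cd where "Cd = measure_pmf.expectation (pmf_of_set (idx M K N)) (\<lambda>i. \<phi> (C i))"
  have nn: "0 \<le> \<Delta>" "0 \<le> Zd" "0 \<le> Er" "0 \<le> Cd"
    by (auto simp: \<Delta>_def Zd_def Er_def Cd_def state_dist_nonneg output_dist_def l1_dist_nonneg
      decoding_error_nonneg intro!: expectation_nonneg \<phi>0)
  \<comment> \<open>Nonnegativity of all summands lets the bound \<open>e\<close> on the sum pass to
    each of them.\<close>
  then have "0 \<le> n * \<Delta>" "0 \<le> n * Zd" by simp_all
  with le[folded \<Delta>_def Zd_def Er_def Cd_def] nn have e\<Delta>Z: "n * (\<Delta> + Zd) \<le> e" and eE: "Er \<le> e" and eC: "Cd \<le> e" and "n * \<Delta> \<le> e"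
    unfolding distrib_left by linarith+
  have e\<Delta>: "\<Delta> \<le> e"
    using \<open>n * \<Delta> \<le> e\<close> mult_right_mono[OF n0(2) nn(1)] by simp
  define I where "I = ideal_joint V W xf M K N C"
  obtain enc where len: "\<And>m k s. length s = n \<Longrightarrow> set_pmf (enc m k s) \<subseteq> {xs. length xs = n}"
    and near: "\<And>F B. (\<And>a. \<bar>F a :: real\<bar> \<le> B) \<Longrightarrow>
      \<bar>measure_pmf.expectation (code_joint_nc n R RK PS W enc) F - measure_pmf.expectation I F\<bar> \<le> B * \<Delta>"
    using ex_code_near_ideal[OF PS pos(3), of n R RK C W xf] C unfolding \<Delta>_def I_def M_def K_def by blast
  define code where "code = code_joint_nc n R RK PS W enc"
  define dec where "dec = lr_decoder (iid_list n p) (mem_chan TY) \<tau>Y M N C"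
  have idx: "finite (idx M K N)" "idx M K N \<noteq> {}" using pos by (auto simp: idx_def)
  have cost: "measure_pmf.expectation code (\<lambda>(m, k, s, x, yz). avg_cost b x) \<le> \<mu> + 1 / sqrt n + (1 + bm) * e"
  proof -
    have "\<bar>measure_pmf.expectation code (\<lambda>(m, k, s, x, yz). avg_cost b x)
        - measure_pmf.expectation I (\<lambda>(m, k, s, x, yz). avg_cost b x)\<bar> \<le> bm * \<Delta>"
      unfolding code_def by (rule near) (auto intro!: abs_avg_cost_le b bm)
    moreover have "bm * \<Delta> \<le> bm * e" by (rule mult_left_mono[OF e\<Delta> bm])
    moreover have "measure_pmf.expectation I (\<lambda>(m, k, s, x, yz). avg_cost b x) \<le> \<mu> + 1 / sqrt n + Cd"
    proof -
      have "measure_pmf.expectation I (\<lambda>(m, k, s, x, yz). avg_cost b x)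
        = measure_pmf.expectation (map_pmf (\<lambda>(m, k, s, x, yz). x) I) (avg_cost b)"
        by (simp add: case_prod_unfold)
      also have "\<dots> = measure_pmf.expectation (pmf_of_set (idx M K N)) (\<lambda>i. measure_pmf.expectation (mem_chan TX (C i)) (avg_cost b))"
        unfolding I_def ideal_joint_input TX_def by (rule expectation_bind_pmf[OF abs_avg_cost_le[OF b bm]])
      also have "\<dots> \<le> measure_pmf.expectation (pmf_of_set (idx M K N)) (\<lambda>i. \<mu> + 1 / sqrt n + \<phi> (C i))"
      proof (rule expectation_mono_finite)
        fix i
        have int: "integrable (mem_chan TX (C i)) f" for f :: "_ \<Rightarrow> real"
          by (intro integrable_measure_pmf_finite) simp
        have "measure_pmf.expectation (mem_chan TX (C i)) (avg_cost b)
          \<le> measure_pmf.expectation (mem_chan TX (C i)) (\<lambda>xs. \<mu> + (1 / sqrt n + sqrt n * (avg_cost b xs - \<mu>)\<^sup>2))"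
        proof (rule expectation_mono_finite)
          fix xs
          show "avg_cost b xs \<le> \<mu> + (1 / sqrt n + sqrt n * (avg_cost b xs - \<mu>)\<^sup>2)"
            using deviation_le_square[OF n0(1), of "avg_cost b xs - \<mu>"] by simp
        qed simp
        also have "\<dots> = \<mu> + 1 / sqrt n + \<phi> (C i)" by (simp add: int \<phi>_def)
        finally show "measure_pmf.expectation (mem_chan TX (C i)) (avg_cost b) \<le> \<mu> + 1 / sqrt n + \<phi> (C i)" .
      qed (use idx in simp)
      also have "\<dots> = \<mu> + 1 / sqrt n + Cd"
        unfolding Cd_def by (subst Bochner_Integration.integral_add)
          (use idx in \<open>simp_all add: integrable_measure_pmf_finite\<close>)
      finally show ?thesis .
    qed
    ultimately show ?thesis using eC by (simp add: distrib_right)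
  qed
  \<comment> \<open>One \<open>e\<close> pays for the change of experiment, the other for decoding
    in the ideal experiment.\<close>
  have error: "measure_pmf.prob code {(m, k, s, x, yz). dec (map fst yz) k \<noteq> m} \<le> 2 * e"
  proof -
    let ?E = "{(m :: nat, k :: nat, s :: 's list, x :: 'x list, yz :: ('y \<times> 'z) list). dec (map fst yz) k \<noteq> m}"
    have "\<bar>measure_pmf.expectation code (indicator ?E) - measure_pmf.expectation I (indicator ?E)\<bar> \<le> 1 * \<Delta>"
      unfolding code_def by (rule near) (simp add: indicator_def)
    then have "\<bar>measure_pmf.prob code ?E - measure_pmf.prob I ?E\<bar> \<le> \<Delta>" by simp
    moreover have "measure_pmf.prob I ?E \<le> Er"
    proof -
      have "measure_pmf.prob I ?E = measure_pmf.prob (map_pmf (\<lambda>(m, k, s, x, yz). (m, k, map fst yz)) I) {(m, k, y). dec y k \<noteq> m}"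
        unfolding measure_map_pmf by (rule arg_cong[where f="measure_pmf.prob I"]) auto
      also have "\<dots> \<le> Er"
        unfolding I_def ideal_joint_receiver Er_def dec_def TY_def by (rule decoding_error_ge[OF pos])
      finally show ?thesis .
    qed
    ultimately show ?thesis using e\<Delta> eE by linarith
  qed
  define PZ where "PZ = map_pmf (\<lambda>(m, k, s, x, yz). map snd yz) code"
  have Qfull: "set_pmf Q = UNIV"
    using q by (auto simp: set_pmf_eq) (metis less_le_not_le order.trans order_refl)
  have sub: "set_pmf PZ \<subseteq> set_pmf (iid_list n Q)"
    unfolding PZ_def code_def by (rule code_warden_support[OF len Qfull])
  have finQ: "finite (set_pmf (iid_list n Q))" by simp
  have finPZ: "finite (set_pmf PZ)" using sub finQ by (rule finite_subset)
  have l1: "l1_dist PZ (iid_list n Q) \<le> \<Delta> + Zd"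
  proof -
    let ?Z = "bind_pmf (pmf_of_set (idx M K N)) (\<lambda>i. mem_chan TZ (C i))"
    have finZ: "finite (set_pmf ?Z)" using idx by simp
    \<comment> \<open>A test of the warden's word is a test of the whole experiment, so
      \<open>near\<close> applies.\<close>
    have "l1_dist PZ ?Z \<le> \<Delta>"
    proof (rule l1_dist_le_by_tests[OF finPZ finZ])
      fix h :: "'z list \<Rightarrow> real" assume h: "\<And>a. \<bar>h a\<bar> \<le> 1"
      have "\<bar>measure_pmf.expectation code (\<lambda>(m, k, s, x, yz). h (map snd yz))
          - measure_pmf.expectation I (\<lambda>(m, k, s, x, yz). h (map snd yz))\<bar> \<le> 1 * \<Delta>"
        unfolding code_def by (rule near) (simp add: h case_prod_unfold)
      then show "\<bar>measure_pmf.expectation PZ h - measure_pmf.expectation ?Z h\<bar> \<le> \<Delta>"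
        unfolding PZ_def TZ_def ideal_joint_warden[symmetric] I_def by (simp add: case_prod_unfold)
    qed
    moreover have "l1_dist ?Z (iid_list n Q) = Zd"
      by (simp add: Zd_def output_dist_def iid_list_bind_mem_chan Q)
    ultimately show ?thesis
      using l1_dist_triangle[OF finPZ finZ finQ] by linarith
  qed
  have qn: "0 < q ^ n" "\<And>zs. zs \<in> set_pmf (iid_list n Q) \<Longrightarrow> q ^ n \<le> pmf (iid_list n Q) zs"
    using q by (auto intro!: pmf_iid_list_ge)
  have q1: "q \<le> 1" using q(2)[of undefined] pmf_le_1[of Q undefined] by linarith
  have lq: "0 \<le> ln (1 / q)" using q q1 by simp
  \<comment> \<open>Here the weight \<open>n\<close> is spent: \<open>ln (1 / q ^ n)\<close> is
    linear in \<open>n\<close>, and \<open>n * (\<Delta> + Zd)\<close> is at most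
    \<open>e\<close>.\<close>
  have "l1_dist PZ (iid_list n Q) * (1 + ln (1 / q ^ n)) \<le> (1 + ln (1 / q)) * e"
  proof -
    have lqn: "ln (1 / q ^ n) = n * ln (1 / q)" using q by (simp add: ln_div ln_realpow)
    have "1 + ln (1 / q ^ n) \<le> n * (1 + ln (1 / q))"
      using n0 unfolding lqn by (simp add: distrib_left)
    moreover have "0 \<le> 1 + ln (1 / q ^ n)"
      using mult_nonneg_nonneg[OF _ lq, of "real n"] unfolding lqn by simp
    ultimately have "l1_dist PZ (iid_list n Q) * (1 + ln (1 / q ^ n)) \<le> (\<Delta> + Zd) * (n * (1 + ln (1 / q)))"
      using l1 nn by (intro mult_mono) auto
    also have "\<dots> = (n * (\<Delta> + Zd)) * (1 + ln (1 / q))" by (simp add: mult_ac)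
    also have "\<dots> \<le> e * (1 + ln (1 / q))"
      using e\<Delta>Z lq by (intro mult_right_mono) auto
    also have "\<dots> = (1 + ln (1 / q)) * e" by (rule mult.commute)
    finally show ?thesis .
  qed
  then have "l1_dist PZ (iid_list n Q) * (1 + ln (1 / q ^ n)) / ln 2 \<le> (1 + ln (1 / q)) / ln 2 * e"
    by (simp add: divide_right_mono)
  with kl_div_le_l1_dist[OF finQ sub qn] have "kl_div PZ (iid_list n Q) \<le> ereal ((1 + ln (1 / q)) / ln 2 * e)"
    by (meson ereal_less_eq(3) order_trans)
  with kl_div_nonneg[OF finQ sub qn] cost error len show ?thesis
    unfolding PZ_def code_def by blast
qed

subsection \<open>Achievable rates\<close>

text \<open>Each of the two ceilings costs a factor \<open>2\<close>, whence the
  \<open>4\<close>.\<close>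

lemma num_idx_product_ratio_le:
  assumes "0 \<le> R" "0 \<le> R'"
  shows "real (num_idx n R) * num_idx n R' / 2 powr (n * r) \<le> 4 * (2 powr (R + R' - r)) ^ n"
proof -
  have "real (num_idx n R) * num_idx n R' \<le> (2 * 2 powr (n * R)) * (2 * 2 powr (n * R'))"
    using assms by (intro mult_mono num_idx_le) auto
  also have "\<dots> = 4 * 2 powr (n * (R + R'))" by (simp add: distrib_left powr_add)
  finally have "real (num_idx n R) * num_idx n R' / 2 powr (n * r) \<le> 4 * 2 powr (n * (R + R')) / 2 powr (n * r)"
    by (rule divide_right_mono) simp
  also have "\<dots> = 4 * 2 powr (n * (R + R') - n * r)" by (simp add: powr_diff)
  also have "n * (R + R') - n * r = (R + R' - r) * real n" by (simp add: algebra_simps)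
  also have "2 powr \<dots> = (2 powr (R + R' - r)) ^ n" by (simp add: powr_realpow flip: powr_powr)
  finally show ?thesis .
qed

lemma two_powr_neg_lt_1: "a < 0 \<Longrightarrow> 2 powr a < (1 :: real)"
  using powr_less_mono[of a 0 2] by simp

lemma tendsto_const_div_sqrt: "(\<lambda>n. c / sqrt (real n)) \<longlonglongrightarrow> 0"
  by (intro tendsto_divide_0[OF tendsto_const] filterlim_at_top_imp_at_infinity
    filterlim_compose[OF sqrt_at_top filterlim_real_sequentially])

lemma tendsto_n_times_le_geometric:
  fixes f :: "nat \<Rightarrow> real"
  assumes "\<And>n. 0 \<le> f n" "\<And>n. f n \<le> \<rho> ^ n" "0 \<le> \<rho>" "\<rho> < 1"
  shows "(\<lambda>n. n * f n) \<longlonglongrightarrow> 0"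
proof (rule tendsto_sandwich[OF _ _ tendsto_const powser_times_n_limit_0[of \<rho>]])
  show "\<forall>\<^sub>F n in sequentially. real n * f n \<le> real n * \<rho> ^ n"
    using assms by (intro always_eventually allI mult_left_mono) auto
qed (use assms in auto)

lemma tendsto_le_geometric:
  fixes f :: "nat \<Rightarrow> real"
  assumes "\<And>n. 0 \<le> f n" "\<And>n. f n \<le> c * \<rho> ^ n" "0 \<le> \<rho>" "\<rho> < 1"
  shows "f \<longlonglongrightarrow> 0"
proof (rule tendsto_sandwich[OF _ _ tendsto_const])
  show "(\<lambda>n. c * \<rho> ^ n) \<longlonglongrightarrow> 0"
    using assms by (intro tendsto_mult_right_zero LIMSEQ_power_zero) auto
qed (use assms in auto)

lemma achievable_positive_rate:
  fixes PS :: "'s::finite pmf" and W :: "'s \<Rightarrow> 'x::finite \<Rightarrow> ('y::finite \<times> 'z::finite) pmf"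
    and p :: "'u::finite pmf" and V :: "'u \<Rightarrow> 's pmf" and xf :: "'u \<Rightarrow> 's \<Rightarrow> 'x" and b :: "'x \<Rightarrow> real"
  defines "TX \<equiv> input_kernel V W xf" and "TY \<equiv> receiver_kernel V W xf" and "TZ \<equiv> warden_kernel V W xf"
  assumes PS: "bind_pmf p V = PS" and PZ: "bind_pmf p TZ = Q0 PS W x0"
    and full: "set_pmf (Q0 PS W x0) = UNIV"
    and cost: "measure_pmf.expectation (bind_pmf p TX) b \<le> B"
    and R: "0 < R" "R < mutual_info (kernel_pair p TY) - mutual_info (kernel_pair p V)"
    and key: "mutual_info (kernel_pair p TZ) - mutual_info (kernel_pair p TY) < RK"
  shows "achievable_nc PS W x0 b RK B R"
proof -
  define IY IS IZ where "IY = mutual_info (kernel_pair p TY)" and "IS = mutual_info (kernel_pair p V)"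
    and "IZ = mutual_info (kernel_pair p TZ)"
  have fin: "finite (set_pmf q)" for q :: "'a::finite pmf" by simp
  have "0 \<le> IS" unfolding IS_def by (rule mutual_info_nonneg[OF fin])
  have "max IS (IZ - R - RK) < IY - R" using R key by (auto simp: IY_def IS_def IZ_def)
  then obtain R' where R': "max IS (IZ - R - RK) < R'" "R' < IY - R" using dense by blast
  \<comment> \<open>Each threshold exponent lies strictly between a mutual information and a
    codebook rate. The first gap makes a tail of the information density decay geometrically, the
    second the term that compares the threshold with the number of codewords.\<close>
  obtain r1 where r1: "IS < r1" "r1 < R'" using R' dense[of IS R'] by auto
  obtain r2 where r2: "IZ < r2" "r2 < R + RK + R'" using R' dense[of IZ "R + RK + R'"] by auto
  obtain r3 where r3: "R + R' < r3" "r3 < IY" using R' dense[of "R + R'" IY] by auto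
  have R'0: "0 \<le> R'" using R' \<open>0 \<le> IS\<close> by auto
  define eS where "eS n = measure_pmf.prob (kernel_pair (iid_list n p) (mem_chan V))
    {(us, s). pmf (mem_chan V us) s > 2 powr (n * r1) * pmf (iid_list n (bind_pmf p V)) s}" for n
  define eZ where "eZ n = measure_pmf.prob (kernel_pair (iid_list n p) (mem_chan TZ))
    {(us, z). pmf (mem_chan TZ us) z > 2 powr (n * r2) * pmf (iid_list n (bind_pmf p TZ)) z}" for n
  define eY where "eY n = measure_pmf.prob (kernel_pair (iid_list n p) (mem_chan TY))
    {(us, y). \<not> pmf (mem_chan TY us) y > 2 powr (n * r3) * pmf (iid_list n (bind_pmf p TY)) y}" for n
  obtain \<rho>S where \<rho>S: "0 \<le> \<rho>S" "\<rho>S < 1" "\<And>n. eS n \<le> \<rho>S ^ n"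
    using information_density_upper_tail[OF fin fin, of p V r1] r1(1)
    unfolding IS_def eS_def kernel_pair_def by blast
  obtain \<rho>Z where \<rho>Z: "0 \<le> \<rho>Z" "\<rho>Z < 1" "\<And>n. eZ n \<le> \<rho>Z ^ n"
    using information_density_upper_tail[OF fin fin, of p TZ r2] r2(1)
    unfolding IZ_def eZ_def kernel_pair_def by blast
  obtain \<rho>Y where \<rho>Y: "0 \<le> \<rho>Y" "\<rho>Y < 1" "\<And>n. eY n \<le> \<rho>Y ^ n"
    using information_density_lower_tail[OF fin fin, of r3 p TY] r3(2)
    unfolding IY_def eY_def kernel_pair_def by blast
  define M K N where "M n = num_idx n R" and "K n = num_idx n RK" and "N n = num_idx n R'" for n
  define \<mu> where "\<mu> = measure_pmf.expectation (bind_pmf p TX) b"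
  define v where "v = measure_pmf.expectation (bind_pmf p TX) (\<lambda>x. (b x - \<mu>)\<^sup>2)"
  define qS where "qS n = sqrt (2 powr (n * r1) / N n)" for n
  define qZ where "qZ n = sqrt (2 powr (n * r2) / (M n * K n * N n))" for n
  define qY where "qY n = M n * N n / 2 powr (n * r3)" for n
  define e where "e n = n * (2 * eS n + qS n) + n * (2 * eZ n + qZ n) + (eY n + qY n) + v / sqrt n" for n
  have lim: "e \<longlonglongrightarrow> 0"
  proof -
    have "(\<lambda>n. n * eS n) \<longlonglongrightarrow> 0" "(\<lambda>n. n * eZ n) \<longlonglongrightarrow> 0"
      by (rule tendsto_n_times_le_geometric[OF _ \<rho>S(3,1,2)] tendsto_n_times_le_geometric[OF _ \<rho>Z(3,1,2)];
          simp add: eS_def eZ_def)+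
    moreover have "(\<lambda>n. n * qS n) \<longlonglongrightarrow> 0"
    proof (rule tendsto_n_times_le_geometric)
      show "qS n \<le> (2 powr ((r1 - R') / 2)) ^ n" for n
        unfolding qS_def N_def by (rule sqrt_rate_ratio_le[OF num_idx_ge])
      show "2 powr ((r1 - R') / 2) < 1" using r1 by (intro two_powr_neg_lt_1) simp
    qed (auto simp: qS_def)
    moreover have "(\<lambda>n. n * qZ n) \<longlonglongrightarrow> 0"
    proof (rule tendsto_n_times_le_geometric)
      show "qZ n \<le> (2 powr ((r2 - (R + RK + R')) / 2)) ^ n" for n
        unfolding qZ_def
      proof (rule sqrt_rate_ratio_le)
        have "2 powr (n * (R + RK + R')) = 2 powr (n * R) * 2 powr (n * RK) * 2 powr (n * R')"
          by (simp add: distrib_left powr_add)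
        also have "\<dots> \<le> real (M n) * K n * N n"
          unfolding M_def K_def N_def by (intro mult_mono num_idx_ge) auto
        finally show "2 powr (n * (R + RK + R')) \<le> real (M n * K n * N n)" by simp
      qed
      show "2 powr ((r2 - (R + RK + R')) / 2) < 1" using r2 by (intro two_powr_neg_lt_1) simp
    qed (auto simp: qZ_def)
    moreover have "eY \<longlonglongrightarrow> 0"
      by (rule tendsto_le_geometric[of _ 1 \<rho>Y]) (use \<rho>Y in \<open>auto simp: eY_def\<close>)
    moreover have "qY \<longlonglongrightarrow> 0"
    proof (rule tendsto_le_geometric)
      show "qY n \<le> 4 * (2 powr (R + R' - r3)) ^ n" for n
        using num_idx_product_ratio_le[of R R' n r3] R R'0 by (simp add: qY_def M_def N_def)
      show "2 powr (R + R' - r3) < 1" using r3 by (intro two_powr_neg_lt_1) simp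
    qed (auto simp: qY_def)
    moreover have "(\<lambda>n. v / sqrt (real n)) \<longlonglongrightarrow> 0" by (rule tendsto_const_div_sqrt)
    ultimately have "(\<lambda>n. (2 * (n * eS n) + n * qS n) + (2 * (n * eZ n) + n * qZ n) + (eY n + qY n) + v / sqrt n)
        \<longlonglongrightarrow> (2 * 0 + 0) + (2 * 0 + 0) + (0 + 0) + 0"
      by (intro tendsto_intros)
    then show ?thesis by (simp add: e_def[abs_def] algebra_simps)
  qed
  define q where "q = Min (range (pmf (Q0 PS W x0)))"
  have q: "0 < q" "\<And>z. q \<le> pmf (Q0 PS W x0) z"
    unfolding q_def by (auto simp: full pmf_positive)
  define bm where "bm = Max (range (\<lambda>x. \<bar>b x\<bar>))"
  have bm: "\<bar>b x\<bar> \<le> bm" for x unfolding bm_def by (rule Max_ge) auto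
  define c where "c = (1 + ln (1 / q)) / ln 2"
  \<comment> \<open>Length \<open>0\<close> has only the length condition; the limits do not see
    it.\<close>
  define P where "P n enc dec \<longleftrightarrow> (\<forall>m k s. length s = n \<longrightarrow> set_pmf (enc m k s) \<subseteq> {xs. length xs = n}) \<and> (n \<ge> 1 \<longrightarrow>
    measure_pmf.expectation (code_joint_nc n R RK PS W enc) (\<lambda>(m, k, s, x, yz). avg_cost b x)
      \<le> \<mu> + 1 / sqrt n + (1 + bm) * e n \<and>
    measure_pmf.prob (code_joint_nc n R RK PS W enc) {(m, k, s, x, yz). dec (map fst yz) k \<noteq> m} \<le> 2 * e n \<and>
    0 \<le> kl_div (map_pmf (\<lambda>(m, k, s, x, yz). map snd yz) (code_joint_nc n R RK PS W enc)) (iid_list n (Q0 PS W x0)) \<and>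
    kl_div (map_pmf (\<lambda>(m, k, s, x, yz). map snd yz) (code_joint_nc n R RK PS W enc)) (iid_list n (Q0 PS W x0))
      \<le> ereal (c * e n))" for n :: nat and enc and dec :: "'y list \<Rightarrow> nat \<Rightarrow> nat"
  have "\<exists>enc dec. P n enc dec" for n
  proof (cases "n \<ge> 1")
    case True
    have "\<exists>enc dec. (\<forall>m k s. length s = n \<longrightarrow> set_pmf (enc m k s) \<subseteq> {xs. length xs = n}) \<and>
      measure_pmf.expectation (code_joint_nc n R RK PS W enc) (\<lambda>(m, k, s, x, yz). avg_cost b x)
        \<le> \<mu> + 1 / sqrt n + (1 + bm) * e n \<and>
      measure_pmf.prob (code_joint_nc n R RK PS W enc) {(m, k, s, x, yz). dec (map fst yz) k \<noteq> m} \<le> 2 * e n \<and>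
      0 \<le> kl_div (map_pmf (\<lambda>(m, k, s, x, yz). map snd yz) (code_joint_nc n R RK PS W enc)) (iid_list n (Q0 PS W x0)) \<and>
      kl_div (map_pmf (\<lambda>(m, k, s, x, yz). map snd yz) (code_joint_nc n R RK PS W enc)) (iid_list n (Q0 PS W x0))
        \<le> ereal (c * e n)"
      unfolding \<mu>_def TX_def c_def
      by (rule ex_code_of_length[where \<tau>S="2 powr (n * r1)" and \<tau>Z="2 powr (n * r2)" and \<tau>Y="2 powr (n * r3)" and R'=R',
            OF True PS PZ[unfolded TZ_def] q bm])
        (simp_all add: e_def eS_def eZ_def eY_def qS_def qZ_def qY_def v_def \<mu>_def M_def K_def N_def TX_def TY_def TZ_def)
    then show ?thesis unfolding P_def by blast
  next
    case False
    then show ?thesis unfolding P_def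
      by (intro exI[of _ "\<lambda>_ _ _. return_pmf (replicate n undefined)"]) auto
  qed
  then obtain enc dec where code: "\<And>n. P n (enc n) (dec n)" by metis
  define J where "J n = code_joint_nc n R RK PS W (enc n)" for n
  have len: "\<forall>n m k s. length s = n \<longrightarrow> set_pmf (enc n m k s) \<subseteq> {xs. length xs = n}"
    using code unfolding P_def by blast
  have ge1: "\<forall>\<^sub>F n in sequentially. n \<ge> (1 :: nat)" by (rule eventually_ge_at_top)
  have cost_lim: "limsup (\<lambda>n. ereal (measure_pmf.expectation (J n) (\<lambda>(m, k, s, x, yz). avg_cost b x))) \<le> ereal B"
  proof -
    have "limsup (\<lambda>n. ereal (measure_pmf.expectation (J n) (\<lambda>(m, k, s, x, yz). avg_cost b x)))
      \<le> limsup (\<lambda>n. ereal (\<mu> + 1 / sqrt n + (1 + bm) * e n))"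
      by (rule Limsup_mono, rule eventually_mono[OF ge1]) (use code in \<open>auto simp: P_def J_def\<close>)
    also have "(\<lambda>n. \<mu> + 1 / sqrt n + (1 + bm) * e n) \<longlonglongrightarrow> \<mu> + 0 + (1 + bm) * 0"
    proof (intro tendsto_intros lim)
      show "(\<lambda>n. 1 / sqrt (real n)) \<longlonglongrightarrow> 0" by (rule tendsto_const_div_sqrt)
    qed
    then have "limsup (\<lambda>n. ereal (\<mu> + 1 / sqrt n + (1 + bm) * e n)) = ereal \<mu>"
      by (intro lim_imp_Limsup) auto
    also have "ereal \<mu> \<le> ereal B" using cost by (simp add: \<mu>_def)
    finally show ?thesis .
  qed
  have error_lim: "(\<lambda>n. measure_pmf.prob (J n) {(m, k, s, x, yz). dec n (map fst yz) k \<noteq> m}) \<longlonglongrightarrow> 0"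
  proof (rule tendsto_sandwich[OF _ _ tendsto_const])
    show "(\<lambda>n. 2 * e n) \<longlonglongrightarrow> 0" using tendsto_mult_right_zero[OF lim, of 2] by simp
    show "\<forall>\<^sub>F n in sequentially. measure_pmf.prob (J n) {(m, k, s, x, yz). dec n (map fst yz) k \<noteq> m} \<le> 2 * e n"
      by (rule eventually_mono[OF ge1]) (use code in \<open>auto simp: P_def J_def\<close>)
  qed simp
  have kl_lim: "(\<lambda>n. kl_div (map_pmf (\<lambda>(m, k, s, x, yz). map snd yz) (J n)) (iid_list n (Q0 PS W x0))) \<longlonglongrightarrow> 0"
  proof (rule tendsto_sandwich[OF _ _ tendsto_const])
    show "(\<lambda>n. ereal (c * e n)) \<longlonglongrightarrow> 0"
      using tendsto_mult_right_zero[OF lim, of c] by (simp add: zero_ereal_def)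
    show "\<forall>\<^sub>F n in sequentially. kl_div (map_pmf (\<lambda>(m, k, s, x, yz). map snd yz) (J n)) (iid_list n (Q0 PS W x0)) \<le> ereal (c * e n)"
      "\<forall>\<^sub>F n in sequentially. 0 \<le> kl_div (map_pmf (\<lambda>(m, k, s, x, yz). map snd yz) (J n)) (iid_list n (Q0 PS W x0))"
      by (rule eventually_mono[OF ge1]; use code in \<open>auto simp: P_def J_def\<close>)+
  qed
  show ?thesis
    unfolding achievable_nc_def
    using len cost_lim error_lim kl_lim unfolding J_def by blast
qed

theorem theorem4:
  fixes PS :: "'s::finite pmf"
    and W :: "'s \<Rightarrow> 'x::finite \<Rightarrow> ('y::finite \<times> 'z::finite) pmf"
    and x0 :: 'x
    and b :: "'x \<Rightarrow> real"
    and RK B :: real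
    and PU :: "'s \<Rightarrow> 'u::finite pmf"
    and xf :: "'u \<Rightarrow> 's \<Rightarrow> 'x"
  assumes b_nonneg: "\<forall>x. b x \<ge> 0"
    and Q0_full: "set_pmf (Q0 PS W x0) = UNIV"
    and RK: "RK \<ge> 0"
    and B: "B \<ge> 0"
    and card_U: "CARD('u) \<le> min (CARD('x) + CARD('y) + CARD('z) + CARD('s) - 2)
                                  (CARD('x) * CARD('s) + 1)"
    and PZ: "map_pmf (\<lambda>(s, u, x, y, z). z) (gp_joint PS PU xf W) = Q0 PS W x0"
    and cost: "measure_pmf.expectation (gp_joint PS PU xf W) (\<lambda>(s, u, x, y, z). b x) \<le> B"
    and key: "mutual_info (map_pmf (\<lambda>(s, u, x, y, z). (u, z)) (gp_joint PS PU xf W))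
              - mutual_info (map_pmf (\<lambda>(s, u, x, y, z). (u, y)) (gp_joint PS PU xf W)) < RK"
  shows "covert_cap_nc PS W x0 b RK B \<ge>
           ereal (mutual_info (map_pmf (\<lambda>(s, u, x, y, z). (u, y)) (gp_joint PS PU xf W))
                - mutual_info (map_pmf (\<lambda>(s, u, x, y, z). (u, s)) (gp_joint PS PU xf W)))"
proof -
  \<comment> \<open>With \<open>u\<close> in first place, disintegration yields the reverse kernel
    from \<open>u\<close> to the state.\<close>
  define US where "US = bind_pmf PS (\<lambda>s. map_pmf (\<lambda>u. (u, s)) (PU s))"
  define p where "p = map_pmf fst US"
  obtain V where V: "US = bind_pmf p (\<lambda>u. map_pmf (Pair u) (V u))"
    using pmf_disintegration[of US] unfolding p_def by blast
  define L where "L = letter_kernel V W xf"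
  have joint: "gp_joint PS PU xf W = bind_pmf p (\<lambda>u. map_pmf (\<lambda>(s, x, yz). (s, u, x, fst yz, snd yz)) (L u))"
  proof -
    have "gp_joint PS PU xf W = bind_pmf US (\<lambda>(u, s). map_pmf (\<lambda>(y, z). (s, u, xf u s, y, z)) (W s (xf u s)))"
      by (simp add: gp_joint_def US_def bind_assoc_pmf bind_map_pmf)
    then show ?thesis
      unfolding V L_def by (simp add: letter_kernel_def bind_assoc_pmf bind_map_pmf map_bind_pmf map_pmf_comp case_prod_unfold)
  qed
  have PS: "bind_pmf p V = PS"
  proof -
    have "bind_pmf p V = map_pmf snd US"
      by (subst V) (simp add: map_bind_pmf map_pmf_comp pmf.map_ident)
    then show ?thesis by (simp add: US_def map_bind_pmf map_pmf_comp bind_return_pmf')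
  qed
  have V_L: "V u = map_pmf fst (L u)" for u
    by (simp add: L_def letter_kernel_def map_bind_pmf map_pmf_comp bind_return_pmf')
  have Z: "bind_pmf p (warden_kernel V W xf) = Q0 PS W x0"
    unfolding PZ[symmetric] joint
    by (simp add: warden_kernel_def[abs_def] L_def map_bind_pmf map_pmf_comp case_prod_unfold)
  have X: "measure_pmf.expectation (bind_pmf p (input_kernel V W xf)) b \<le> B"
  proof -
    have "bind_pmf p (input_kernel V W xf) = map_pmf (\<lambda>(s, u, x, y, z). x) (gp_joint PS PU xf W)"
      unfolding joint by (simp add: input_kernel_def[abs_def] L_def map_bind_pmf map_pmf_comp case_prod_unfold)
    with cost show ?thesis by (simp add: case_prod_unfold)
  qed
  have UZ: "map_pmf (\<lambda>(s, u, x, y, z). (u, z)) (gp_joint PS PU xf W) = kernel_pair p (warden_kernel V W xf)"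
    and UY: "map_pmf (\<lambda>(s, u, x, y, z). (u, y)) (gp_joint PS PU xf W) = kernel_pair p (receiver_kernel V W xf)"
    unfolding joint kernel_pair_def
    by (simp_all add: warden_kernel_def receiver_kernel_def L_def map_bind_pmf map_pmf_comp case_prod_unfold)
  have US: "map_pmf (\<lambda>(s, u, x, y, z). (u, s)) (gp_joint PS PU xf W) = kernel_pair p V"
    unfolding joint V_L kernel_pair_def by (simp add: map_bind_pmf map_pmf_comp case_prod_unfold)
  define Rs where "Rs = mutual_info (kernel_pair p (receiver_kernel V W xf)) - mutual_info (kernel_pair p V)"
  have ach: "achievable_nc PS W x0 b RK B R" if "R < Rs" for R
  proof (cases "R \<le> 0")
    case True
    show ?thesis by (rule achievable_nonpos_rate[OF True B PS Z X])
  next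
    case False
    then show ?thesis
      using that key by (intro achievable_positive_rate[OF PS Z Q0_full X]) (auto simp: Rs_def UZ UY)
  qed
  \<comment> \<open>The value \<open>Rs\<close> itself need not be achieved: the supremum is reached
    through the rates strictly below it, which leave the slack for \<open>R'\<close>.\<close>
  have "ereal Rs \<le> covert_cap_nc PS W x0 b RK B"
    unfolding covert_cap_nc_def
  proof (rule le_Sup_iff[THEN iffD2, rule_format])
    fix y assume "y < ereal Rs"
    then obtain R where "y < ereal R" "R < Rs" using ereal_dense2[of y "ereal Rs"] by auto
    then show "\<exists>a\<in>{ereal R |R. achievable_nc PS W x0 b RK B R}. y < a"
      using ach[of R] by blast
  qed
  then show ?thesis unfolding UY US Rs_def .
qed

end
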